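(* Let $\mathbf{L}$, $\mathbf{Y}$ and $\mathbf{Z}$ be random vectors related by $$\mathbf{Y} = A\mathbf{L} + \mathbf{E}_Y,\qquad \mathbf{Z} = B\mathbf{L} + \mathbf{E}_Z,$$ where $A$ and $B$ are constant matrices and $\mathbf{E}_Y,\mathbf{E}_Z$ are random vectors. Let $l$ be the dimension of $\mathbf{L}$, and assume that $A$ has full column rank. Suppose that 1) $\mathrm{Dim}(\mathbf{Y}) > l$; 2) $\mathbf{E}_Y$ is independent of $\mathbf{L}$; 3) $\mathbf{E}_Y$ is independent of $\mathbf{E}_Z$ (it is not assumed that $\mathbf{E}_Z$ is independent of $\mathbf{L}$); 4) the cross-covariance matrix $\boldsymbol{\Sigma}_{LZ} = \mathbb{E}[\mathbf{L}\mathbf{Z}^\intercal]$ has rank $l$. Then $E_{\mathbf{Y}||\mathbf{Z}}$ is independent of $\mathbf{Z}$, i.e. $(\mathbf{Z},\mathbf{Y})$ satisfies the GIN condition.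
   Context: Standing assumptions: all random variables have zero mean and finite variance, and the variables follow a linear non-Gaussian acyclic causal model. In particular, every component of $\mathbf{L}$, $\mathbf{E}_Y$ and $\mathbf{E}_Z$ is a linear combination of finitely many mutually independent non-Gaussian noise variables. $\mathrm{Dim}$ denotes the dimension of a random vector. GIN (Generalized Independent Noise) condition: for random vectors $\mathbf{Y}$ and $\mathbf{Z}$, the surrogate variable of $\mathbf{Y}$ relative to $\mathbf{Z}$ is $E_{\mathbf{Y}||\mathbf{Z}} := \omega^\intercal\mathbf{Y}$, where $\omega$ is a constant vector with $\omega^\intercal\mathbb{E}[\mathbf{Y}\mathbf{Z}^\intercal]=\mathbf{0}$ and $\omega\neq\mathbf{0}$. The ordered pair $(\mathbf{Z},\mathbf{Y})$ satisfies the GIN condition if and only if $E_{\mathbf{Y}||\mathbf{Z}}$ is (statistically) independent of $\mathbf{Z}$. That is: at least one nonzero $\omega$ with $\omega^\intercal\mathbb{E}[\mathbf{Y}\mathbf{Z}^\intercal]=\mathbf{0}$ exists, and for every such $\omega$ the variable $\omega^\intercal\mathbf{Y}$ is independent of the random vector $\mathbf{Z}$. *)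

theory Defs
  imports "HOL-Probability.Probability"
begin

context prob_space
begin

definition centered_var :: "('a \<Rightarrow> real) \<Rightarrow> bool" where
  "centered_var X \<longleftrightarrow> random_variable borel X \<and> integrable M (\<lambda>x. (X x)\<^sup>2) \<and> expectation X = 0"

definition centered_vec :: "('a \<Rightarrow> real ^ 'n) \<Rightarrow> bool" where
  "centered_vec V \<longleftrightarrow> random_variable borel V \<and> (\<forall>i. centered_var (\<lambda>x. V x $ i))"

text \<open>Only nondegenerate normal laws count as Gaussian, so an almost surely constant
  noise is allowed as non-Gaussian; this makes the noise hypothesis weaker.\<close>

definition gaussian :: "('a \<Rightarrow> real) \<Rightarrow> bool" where
  "gaussian X \<longleftrightarrow> (\<exists>\<mu> \<sigma>. \<sigma> > 0 \<and> distributed M lborel X (normal_density \<mu> \<sigma>))"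

definition linear_combination_of :: "('i \<Rightarrow> 'a \<Rightarrow> real) \<Rightarrow> 'i set \<Rightarrow> ('a \<Rightarrow> real) \<Rightarrow> bool" where
  "linear_combination_of \<epsilon> I X \<longleftrightarrow> (\<exists>c. AE x in M. X x = (\<Sum>k\<in>I. c k * \<epsilon> k x))"

text \<open>Library \<open>indep_var\<close> forces both variables into the same codomain type; this is the
  same notion for two different codomains.\<close>

definition indep_rv :: "'b measure \<Rightarrow> ('a \<Rightarrow> 'b) \<Rightarrow> 'c measure \<Rightarrow> ('a \<Rightarrow> 'c) \<Rightarrow> bool" where
  "indep_rv S X T Y \<longleftrightarrow> random_variable S X \<and> random_variable T Y \<and>
     indep_set (sigma_sets (space M) {X -` A \<inter> space M |A. A \<in> sets S})
               (sigma_sets (space M) {Y -` A \<inter> space M |A. A \<in> sets T})"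

lemma indep_rv_iff_indep_var: "indep_rv S X T Y \<longleftrightarrow> indep_var S X T Y"
  by (auto simp: indep_rv_def indep_var_eq)

text \<open>The matrix \<open>E[U V\<^sup>T]\<close>; the cross-covariance matrix when \<open>U\<close> and \<open>V\<close> are centered.\<close>

definition cross_cov :: "('a \<Rightarrow> real ^ 'n) \<Rightarrow> ('a \<Rightarrow> real ^ 'm) \<Rightarrow> real ^ 'm ^ 'n" where
  "cross_cov U V = (\<chi> i j. expectation (\<lambda>x. U x $ i * V x $ j))"

text \<open>The nonzero coefficient vectors \<open>w\<close> for which \<open>w \<bullet> Y\<close> is a surrogate variable of
  \<open>Y\<close> relative to \<open>Z\<close>.\<close>

definition surrogate_coeffs :: "('a \<Rightarrow> real ^ 'n) \<Rightarrow> ('a \<Rightarrow> real ^ 'm) \<Rightarrow> (real ^ 'n) set" where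
  "surrogate_coeffs Y Z = {w. w \<noteq> 0 \<and> w v* cross_cov Y Z = 0}"

text \<open>The pair is ordered with \<open>Z\<close> first.\<close>

definition GIN :: "('a \<Rightarrow> real ^ 'm) \<Rightarrow> ('a \<Rightarrow> real ^ 'n) \<Rightarrow> bool" where
  "GIN Z Y \<longleftrightarrow> surrogate_coeffs Y Z \<noteq> {} \<and>
     (\<forall>w\<in>surrogate_coeffs Y Z. indep_rv borel (\<lambda>x. w \<bullet> Y x) borel Z)"

end

end

theory Submission
  imports Defs "HOL-Complex_Analysis.Complex_Analysis"
begin

text \<open>A vector \<open>w\<close> with \<open>w\<^sup>T E[Y Z\<^sup>T] = 0\<close> satisfies \<open>w\<^sup>T A = 0\<close>, because
  \<open>E[Y Z\<^sup>T] = A E[L Z\<^sup>T]\<close> and \<open>E[L Z\<^sup>T]\<close> has full row rank; so the surrogate is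
  \<open>w\<^sup>T E\<^sub>Y\<close>, and everything rests on \<open>E\<^sub>Y\<close> being independent of \<open>Z\<close>. That does not follow
  from the two pairwise independence hypotheses alone; it follows because, by the
  Darmois--Skitovich theorem, a nonzero non-Gaussian noise cannot occur in both members of an
  independent pair of linear combinations, so \<open>E\<^sub>Y\<close> and \<open>(L, E\<^sub>Z)\<close> use disjoint sets of noises.

  Darmois--Skitovich is proved with moments. Dropping the unshared noises leaves two
  combinations \<open>U, V\<close> whose joint characteristic function factorises near \<open>0\<close>. Hence
  \<open>E[sin(hU)\<^sup>p sin(hV)\<^sup>q]\<close> factorises for small \<open>h\<close>; with Fatou's lemma this doubles the
  number of finite moments again and again, and in the limit it gives
  \<open>E[U\<^sup>p V\<^sup>q] = E[U\<^sup>p] E[V\<^sup>q]\<close>. In terms of cumulants, all but finitely many cumulants vanish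
  for the sum of the shared noises with a given ratio of coefficients. Its moment generating
  function is therefore the exponential of a polynomial, so that of each summand is
  zero-free of finite order, hence \<open>exp H\<close> with \<open>H\<close> a polynomial, and the ridge inequality
  \<open>Re H(z) \<le> Re H(Re z)\<close> forces \<open>H\<close> to be quadratic.\<close>

section \<open>Entire functions of polynomial growth\<close>

text \<open>The map u / (2A - u) sends the half-plane Re u < A into the unit disc and fixes 0, so
  the Schwarz lemma applies to the rescaled function \<open>g\<close>. At half the radius it gives
  |g| \<le> 1/2, which unfolds to 2|f| \<le> |2A - f| \<le> 2A + |f|.\<close>

lemma borel_caratheodory:
  fixes f :: "complex \<Rightarrow> complex"
  assumes hol: "f holomorphic_on ball 0 R" and "f 0 = 0" and "A > 0"
    and re: "\<And>z. norm z < R \<Longrightarrow> Re (f z) < A" and z: "2 * norm z \<le> R" "R > 0"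
  shows "norm (f z) \<le> 2 * A"
proof -
  define g where "g w = f (of_real R * w) / (2 * of_real A - f (of_real R * w))" for w
  have in_ball: "norm (of_real R * w) < R" if "norm w < 1" for w :: complex
    using that \<open>R > 0\<close> by (simp add: norm_mult)
  have nz: "2 * of_real A - f (of_real R * w) \<noteq> 0" if "norm w < 1" for w
  proof
    assume "2 * of_real A - f (of_real R * w) = 0"
    then have "Re (2 * of_real A - f (of_real R * w)) = 0" by simp
    with re[OF in_ball[OF that]] \<open>A > 0\<close> show False by simp
  qed
  have "(\<lambda>w. f (of_real R * w)) holomorphic_on ball 0 1"
    by (rule holomorphic_on_compose_gen[OF _ hol, unfolded o_def])
      (auto intro!: holomorphic_intros simp: in_ball)
  then have holg: "g holomorphic_on ball 0 1"
    unfolding g_def by (intro holomorphic_intros) (use nz in auto)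
  have lt: "norm (g w) < 1" if "norm w < 1" for w
  proof -
    let ?u = "f (of_real R * w)"
    have "Re ?u < A" using re[OF in_ball[OF that]] .
    \<comment> \<open>The points 0 and 2A lie on the real axis, so being nearer to 0 than to 2A is a
      comparison of real parts only.\<close>
    then have "(Re ?u)\<^sup>2 < (2 * A - Re ?u)\<^sup>2"
      using \<open>A > 0\<close> by (simp add: power2_eq_square algebra_simps)
    then have "(norm ?u)\<^sup>2 < (norm (2 * of_real A - ?u))\<^sup>2"
      by (simp add: cmod_power2)
    then have "norm ?u < norm (2 * of_real A - ?u)"
      using power_less_imp_less_base by fastforce
    then show ?thesis
      unfolding g_def norm_divide using nz[OF that] by (simp add: divide_less_eq)
  qed
  define w where "w = z / of_real R"
  have w: "norm w \<le> 1 / 2" "z = of_real R * w"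
    using z by (auto simp: w_def norm_divide field_simps)
  have "norm (g w) \<le> norm w"
    by (rule Schwarz_Lemma(1)[OF holg _ lt]) (use w \<open>f 0 = 0\<close> in \<open>auto simp: g_def\<close>)
  then have "norm (g w) \<le> 1 / 2" using w by simp
  then have "2 * norm (f z) \<le> norm (2 * of_real A - f z)"
    using nz[of w] w unfolding g_def w(2)[symmetric] by (simp add: norm_divide field_simps)
  also have "\<dots> \<le> 2 * A + norm (f z)"
    using norm_triangle_ineq4[of "2 * of_real A" "f z"] \<open>A > 0\<close> by (simp add: norm_mult)
  finally show ?thesis by simp
qed

text \<open>Borel-Caratheodory on the disc of radius 2|z| turns the one-sided bound into a bound of
  order |z|^d on f - f(0), and Liouville's theorem for polynomial growth finishes.\<close>

lemma entire_Re_bound_imp_poly: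
  fixes f :: "complex \<Rightarrow> complex"
  assumes hol: "f holomorphic_on UNIV" and C: "C \<ge> 0"
    and re: "\<And>z. Re (f z) \<le> C * (1 + norm z) ^ d"
  shows "\<exists>p. \<forall>z. f z = poly p z"
proof -
  let ?g = "\<lambda>z. f z - f 0"
  \<comment> \<open>The summands of \<open>B\<close> absorb the strictness of the inequality, the
    bound on Re f(w) and the term -Re f(0). The base 4|z| used below dominates 1 + |w| for |w| <
    2|z| and |z| \<ge> 1.\<close>
  define B where "B = 1 + C + norm (f 0)"
  have B: "B > 0" using C by (simp add: B_def add_pos_nonneg)
  have "norm (?g z) \<le> (2 * B * 4 ^ d) * norm z ^ d" if "1 \<le> norm z" for z
  proof -
    have "norm (?g z) \<le> 2 * (B * (4 * norm z) ^ d)"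
    proof (rule borel_caratheodory[where f="?g" and R="2 * norm z"])
      show "?g holomorphic_on ball 0 (2 * norm z)"
        by (intro holomorphic_intros holomorphic_on_subset[OF hol]) auto
      show "0 < B * (4 * norm z) ^ d" using B that by (intro mult_pos_pos zero_less_power) auto
      fix w :: complex assume w: "norm w < 2 * norm z"
      have one: "1 \<le> (4 * norm z) ^ d" using that by (intro one_le_power) auto
      have "(1 + norm w) ^ d \<le> (4 * norm z) ^ d"
        using w that by (intro power_mono) auto
      then have "C * (1 + norm w) ^ d \<le> C * (4 * norm z) ^ d"
        using C by (rule mult_left_mono)
      then have "Re (f w) \<le> C * (4 * norm z) ^ d" using re[of w] by linarith
      moreover have "- Re (f 0) \<le> norm (f 0)" using abs_Re_le_cmod[of "f 0"] by linarith
      moreover have "norm (f 0) * 1 \<le> norm (f 0) * (4 * norm z) ^ d"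
        using one by (intro mult_left_mono) auto
      moreover have "0 < (4 * norm z) ^ d" using one by linarith
      ultimately show "Re (?g w) < B * (4 * norm z) ^ d"
        by (simp add: B_def distrib_right)
    qed (use that in auto)
    then show ?thesis by (simp add: power_mult_distrib)
  qed
  then have "?g z = (\<Sum>k\<le>d. (deriv ^^ k) ?g 0 / fact k * z ^ k)" for z
    by (intro Liouville_polynomial[where A=1]) (auto intro!: holomorphic_intros hol)
  then have "f z = poly ([:f 0:] + (\<Sum>k\<le>d. monom ((deriv ^^ k) ?g 0 / fact k) k)) z" for z
  proof -
    have "f z = f 0 + ?g z" by simp
    also have "?g z = (\<Sum>k\<le>d. (deriv ^^ k) ?g 0 / fact k * z ^ k)" by fact
    finally show ?thesis by (simp only: poly_add poly_sum poly_monom poly_pCons poly_0) simp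
  qed
  then show ?thesis by blast
qed

text \<open>Serves to pass from an inequality between values of a polynomial to one between leading
  forms. At \<open>w = 0\<close> one cannot divide by a power of \<open>w\<close>, and the positive
  degree gives the limit 0.\<close>

lemma poly_ray_tendsto:
  fixes p :: "complex poly"
  assumes "degree p > 0"
  shows "((\<lambda>r::real. poly p (of_real r * w) / of_real r ^ degree p) \<longlongrightarrow> lead_coeff p * w ^ degree p) at_top"
proof (cases "w = 0")
  case True
  have "filterlim (\<lambda>r::real. \<bar>r\<bar> ^ degree p) at_top at_top"
    by (intro filterlim_pow_at_top assms filterlim_abs_real)
  then have "filterlim (\<lambda>r::real. (of_real r :: complex) ^ degree p) at_infinity at_top"
    by (intro filterlim_norm_at_top_imp_at_infinity) (simp add: norm_power)
  then have "((\<lambda>r::real. poly p 0 / (of_real r :: complex) ^ degree p) \<longlongrightarrow> 0) at_top"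
    by (intro tendsto_divide_0[OF tendsto_const])
  moreover have "lead_coeff p * w ^ degree p = 0" using True assms by simp
  ultimately show ?thesis using True by (simp only: mult_zero_right)
next
  case False
  have "filterlim (\<lambda>r::real. of_real r * w) at_infinity at_top"
    by (intro filterlim_norm_at_top_imp_at_infinity)
      (use False in \<open>simp add: norm_mult mult.commute[of _ "norm w"]
        filterlim_tendsto_pos_mult_at_top[OF tendsto_const _ filterlim_abs_real]\<close>)
  from filterlim_compose[OF poly_divide_tendsto_aux[of p] this]
  have "((\<lambda>r. poly p (of_real r * w) / (of_real r * w) ^ degree p * w ^ degree p) \<longlongrightarrow> lead_coeff p * w ^ degree p) at_top"
    by (intro tendsto_intros)
  then show ?thesis
    using False by (simp add: power_mult_distrib)
qed

text \<open>Along rays the inequality passes to the leading form c w^d. A direction with c w^d = |c|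
  is thereby forced to be real. Neighbouring directions of this kind differ by the angle 2 pi / d,
  which must then be a multiple of pi, so d divides 2.\<close>

lemma ridge_poly_degree_le_2:
  fixes p :: "complex poly"
  assumes ridge: "\<And>z. Re (poly p z) \<le> Re (poly p (of_real (Re z)))"
  shows "degree p \<le> 2"
proof (rule ccontr)
  define d where "d = degree p"
  define c where "c = lead_coeff p"
  assume "\<not> ?thesis"
  then have d: "d > 2" by (simp add: d_def)
  then have c: "c \<noteq> 0" by (auto simp: c_def d_def)
  have key: "Re (c * w ^ d) \<le> Re (c * of_real (Re w) ^ d)" for w
  proof (rule tendsto_le)
    show "((\<lambda>r::real. Re (poly p (of_real r * w) / of_real r ^ d)) \<longlongrightarrow> Re (c * w ^ d)) at_top"
      "((\<lambda>r::real. Re (poly p (of_real r * of_real (Re w)) / of_real r ^ d)) \<longlongrightarrow> Re (c * of_real (Re w) ^ d)) at_top"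
      using d unfolding c_def d_def by (intro tendsto_Re poly_ray_tendsto; simp)+
    show "\<forall>\<^sub>F r in at_top. Re (poly p (of_real r * w) / of_real r ^ d) \<le> Re (poly p (of_real r * of_real (Re w)) / of_real r ^ d)"
      using eventually_gt_at_top[of "0::real"]
    proof eventually_elim
      case (elim r)
      have "Re (poly p (of_real r * w)) \<le> Re (poly p (of_real r * of_real (Re w)))"
        using ridge[of "of_real r * w"] by simp
      then show ?case
        using elim by (simp flip: of_real_power add: divide_right_mono)
    qed
  qed simp
  \<comment> \<open>The angles of the d-th roots of |c| / c; only the two neighbouring ones with j =
    0 and j = 1 are compared.\<close>
  define \<theta> where "\<theta> j = (2 * pi * of_int j - Arg c) / of_nat d" for j :: int
  have "\<exists>m::int. \<theta> j = of_int m * pi" for j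
  proof -
    have "cis (\<theta> j) ^ d = cis (2 * pi * of_int j - Arg c)"
    proof -
      have "real d * \<theta> j = 2 * pi * of_int j - Arg c" using d by (simp add: \<theta>_def)
      then show ?thesis by (simp only: Complex.DeMoivre)
    qed
    also have "\<dots> = cis (2 * pi * of_int j) / cis (Arg c)"
      by (simp only: cis_divide)
    also have "\<dots> = inverse (cis (Arg c))"
      by (simp only: cis_multiple_2pi[OF Ints_of_int] inverse_eq_divide)
    finally have "c * cis (\<theta> j) ^ d = of_real (norm c)"
      using c by (simp add: cis_Arg sgn_div_norm scaleR_conv_of_real)
    with key[of "cis (\<theta> j)"] have "norm c \<le> Re c * cos (\<theta> j) ^ d"
      by (simp flip: of_real_power)
    also have "\<dots> \<le> norm c * \<bar>cos (\<theta> j)\<bar> ^ d"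
    proof -
      have "Re c * cos (\<theta> j) ^ d \<le> \<bar>Re c\<bar> * \<bar>cos (\<theta> j)\<bar> ^ d"
        by (metis abs_ge_self abs_mult power_abs)
      also have "\<dots> \<le> norm c * \<bar>cos (\<theta> j)\<bar> ^ d"
        by (intro mult_right_mono abs_Re_le_cmod) simp
      finally show ?thesis .
    qed
    finally have "1 \<le> \<bar>cos (\<theta> j)\<bar> ^ d" using c by simp
    moreover have "\<bar>cos (\<theta> j)\<bar> ^ d \<le> \<bar>cos (\<theta> j)\<bar> ^ 1"
      using d by (intro power_decreasing) auto
    ultimately have "\<bar>cos (\<theta> j)\<bar> = 1"
      using abs_cos_le_one[of "\<theta> j"] unfolding power_one_right by linarith
    then have "(cos (\<theta> j))\<^sup>2 = 1" by (metis one_power2 power2_abs)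
    then have "sin (\<theta> j) = 0" using sin_cos_squared_add[of "\<theta> j"] by simp
    then show ?thesis by (simp add: sin_zero_iff_int2)
  qed
  then obtain m0 m1 :: int where m: "\<theta> 0 = of_int m0 * pi" "\<theta> 1 = of_int m1 * pi" by metis
  have "\<theta> 1 - \<theta> 0 = 2 * pi / of_nat d" by (simp add: \<theta>_def diff_divide_distrib)
  then have "(of_int m1 - of_int m0) * pi * of_nat d = 2 * pi"
    using m d by (simp add: field_simps)
  then have "(of_int m1 - of_int m0) * of_nat d = (2 :: real)"
    by simp
  then have "of_int ((m1 - m0) * int d) = (of_int 2 :: real)" by simp
  then have "(m1 - m0) * int d = 2" by linarith
  then have "int d dvd 2" by (metis dvd_triv_right)
  then have "int d \<le> 2" by (rule zdvd_imp_le) simp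
  then show False using d by simp
qed

section \<open>Formal differential equations and exponentials of polynomials\<close>

lemma pderiv_sum: "pderiv (sum f A) = (\<Sum>x\<in>A. pderiv (f x))"
  using higher_pderiv_sum[of 1] by simp

text \<open>The Taylor series of exp Q, with Q' = q and Q(0) = 0, solves the same formal equation
  with the same constant term, so the quotient of the two series has derivative 0 and equals 1.
  Convergence everywhere comes from exp Q being entire.\<close>

lemma sums_exp_poly_of_log_deriv:
  fixes F :: "complex fps"
  assumes F: "fps_deriv F = fps_of_poly q * F" and F0: "fps_nth F 0 = 1"
  shows "\<exists>Q. \<forall>z. (\<lambda>n. fps_nth F n * z ^ n) sums exp (poly Q z)"
proof -
  define Q where "Q = (\<Sum>n\<le>degree q. monom (coeff q n / of_nat (Suc n)) (Suc n))"
  have "pderiv Q = (\<Sum>n\<le>degree q. monom (coeff q n) n)"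
  proof -
    have "of_nat (Suc n) * (c / of_nat (Suc n)) = (c::complex)" for n c
      by (simp del: of_nat_Suc)
    then show ?thesis
      by (simp add: Q_def pderiv_sum pderiv_monom del: of_nat_Suc)
  qed
  then have pd: "pderiv Q = q" by (simp add: poly_as_sum_of_monoms)
  have Q0: "poly Q 0 = 0" by (simp add: Q_def poly_sum poly_monom)
  define g where "g z = exp (poly Q z)" for z
  have der: "(g has_field_derivative poly q z * g z) (at z)" for z
    unfolding g_def pd[symmetric] by (auto intro!: derivative_eq_intros poly_DERIV)
  then have hol: "g holomorphic_on UNIV"
    using field_differentiable_def field_differentiable_at_within holomorphic_on_def by blast
  define E where "E = fps_expansion g 0"
  have E: "g has_fps_expansion E" unfolding E_def using hol by blast
  have "deriv g = (\<lambda>z. poly q z * g z)" using DERIV_imp_deriv[OF der] by auto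
  then have "(\<lambda>z. poly q z * g z) has_fps_expansion fps_deriv E"
    using has_fps_expansion_deriv[OF E] by simp
  moreover have "(\<lambda>z. poly q z * g z) has_fps_expansion fps_of_poly q * E"
    by (intro has_fps_expansion_mult E) (simp add: has_fps_expansion_def)
  ultimately have dE: "fps_deriv E = fps_of_poly q * E"
    using fps_expansion_unique_complex by blast
  have E0: "fps_nth E 0 = 1" by (simp add: E_def fps_expansion_def g_def Q0)
  have inv: "E * inverse E = 1" using E0 by (simp add: inverse_mult_eq_1')
  have "fps_deriv (F * inverse E) = 0"
  proof -
    have "E * (inverse E)\<^sup>2 = inverse E"
      using inv by (simp add: power2_eq_square flip: mult.assoc)
    then show ?thesis using F dE E0 by (simp add: fps_inverse_deriv algebra_simps)
  qed
  then have "F * inverse E = fps_const (fps_nth (F * inverse E) 0)" by (simp only: fps_deriv_eq_0_iff)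
  also have "\<dots> = 1" using E0 F0 by simp
  finally have "F = E" by (metis inv mult.assoc mult.commute mult_1)
  moreover have "(\<lambda>n. fps_nth E n * z ^ n) sums g z" for z
  proof -
    have "fps_conv_radius E \<ge> \<infinity>" unfolding E_def
      by (rule conv_radius_fps_expansion) (use hol in auto)
    then have "(\<lambda>n. fps_nth E n * z ^ n) sums eval_fps E z"
      by (intro sums_eval_fps) auto
    moreover have "eval_fps E z = g z"
      using eval_fps_expansion'[of g 0 \<infinity> z] hol by (simp add: E_def)
    ultimately show ?thesis by simp
  qed
  ultimately show ?thesis unfolding g_def by blast
qed

section \<open>Moments and moment series\<close>

text \<open>On a moment series, coefficient n is the cumulant of order n + 1 divided by n!. The
  logarithmic derivative turns products into sums as a formal logarithm would, with no composition
  of series.\<close>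

definition log_deriv :: "'a::field fps \<Rightarrow> 'a fps" where
  "log_deriv F = fps_deriv F * inverse F"

lemma log_deriv_mult:
  fixes F G :: "'a::field fps"
  assumes "fps_nth F 0 \<noteq> 0" "fps_nth G 0 \<noteq> 0"
  shows "log_deriv (F * G) = log_deriv F + log_deriv G"
proof -
  have "F * inverse F = 1" "G * inverse G = 1"
    using assms by (simp_all add: inverse_mult_eq_1')
  moreover have "log_deriv (F * G) = fps_deriv F * inverse F * (G * inverse G) + fps_deriv G * inverse G * (F * inverse F)"
    by (simp add: log_deriv_def fps_inverse_mult algebra_simps)
  ultimately show ?thesis
    by (simp add: log_deriv_def)
qed

lemma log_deriv_prod:
  fixes F :: "'k \<Rightarrow> 'a::field fps"
  assumes "\<And>k. k \<in> K \<Longrightarrow> fps_nth (F k) 0 \<noteq> 0"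
  shows "log_deriv (\<Prod>k\<in>K. F k) = (\<Sum>k\<in>K. log_deriv (F k))"
  using assms
proof (induction K rule: infinite_finite_induct)
  case (insert k K)
  have "fps_nth (\<Prod>k\<in>K. F k) 0 = (\<Prod>k\<in>K. fps_nth (F k) 0)" for K
    by (induction K rule: infinite_finite_induct) auto
  then show ?case using insert by (simp add: log_deriv_mult)
qed (simp_all add: log_deriv_def)

text \<open>The substitution F(cX), including the case c = 0.\<close>

definition fps_scale :: "'a::field \<Rightarrow> 'a fps \<Rightarrow> 'a fps" where
  "fps_scale c F = Abs_fps (\<lambda>n. c ^ n * fps_nth F n)"

lemma fps_nth_scale [simp]: "fps_nth (fps_scale c F) n = c ^ n * fps_nth F n"
  by (simp add: fps_scale_def)

lemma fps_scale_mult: "fps_scale c (F * G) = fps_scale c F * fps_scale c G"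
proof (rule fps_ext)
  fix n
  have "c ^ n * (fps_nth F i * fps_nth G (n - i)) = c ^ i * fps_nth F i * (c ^ (n - i) * fps_nth G (n - i))"
    if "i \<in> {0..n}" for i
    using that power_add[of c i "n - i"] by (simp add: algebra_simps)
  then have "(\<Sum>i=0..n. c ^ n * (fps_nth F i * fps_nth G (n - i))) =
      (\<Sum>i=0..n. c ^ i * fps_nth F i * (c ^ (n - i) * fps_nth G (n - i)))"
    by (intro sum.cong refl)
  then show "fps_nth (fps_scale c (F * G)) n = fps_nth (fps_scale c F * fps_scale c G) n"
    by (simp add: fps_mult_nth sum_distrib_left)
qed

text \<open>Homogeneity of cumulants. The exponent is \<open>Suc n\<close> because differentiating
  F(cX) yields one further factor c.\<close>

lemma fps_nth_log_deriv_scale: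
  fixes F :: "'a::field fps"
  assumes "fps_nth F 0 \<noteq> 0"
  shows "fps_nth (log_deriv (fps_scale c F)) n = c ^ Suc n * fps_nth (log_deriv F) n"
proof -
  have "fps_scale c F * fps_scale c (inverse F) = fps_scale c (F * inverse F)"
    by (simp add: fps_scale_mult)
  also have "\<dots> = 1"
    using assms by (simp add: inverse_mult_eq_1' fps_eq_iff)
  finally have inv: "inverse (fps_scale c F) = fps_scale c (inverse F)"
    using assms by (intro fps_inverse_unique)
  have "fps_deriv (fps_scale c F) = fps_const c * fps_scale c (fps_deriv F)"
    by (rule fps_ext) (simp add: algebra_simps)
  then have "log_deriv (fps_scale c F) = fps_const c * fps_scale c (log_deriv F)"
    by (simp add: log_deriv_def inv fps_scale_mult mult.assoc)
  then show ?thesis by (simp add: mult.assoc)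
qed

lemma abs_mult_le_sum_squares: "\<bar>a * b\<bar> \<le> \<bar>a\<^sup>2 + b\<^sup>2\<bar>" for a b :: real
proof -
  have "0 \<le> \<bar>a\<bar> * \<bar>b\<bar>" by simp
  moreover have "2 * (\<bar>a\<bar> * \<bar>b\<bar>) \<le> a\<^sup>2 + b\<^sup>2"
    using sum_squares_bound[of "\<bar>a\<bar>" "\<bar>b\<bar>"] by (simp add: mult.assoc)
  ultimately have "\<bar>a\<bar> * \<bar>b\<bar> \<le> a\<^sup>2 + b\<^sup>2" by linarith
  then show ?thesis by (simp add: abs_mult)
qed

section \<open>Moments and moment series of sums\<close>

context prob_space
begin

definition all_moments :: "('a \<Rightarrow> real) \<Rightarrow> bool" where
  "all_moments X \<longleftrightarrow> random_variable borel X \<and> (\<forall>n. integrable M (\<lambda>x. X x ^ n))"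

text \<open>The moment generating function as a formal series, since the moments may grow too fast
  for convergence. Complex coefficients allow comparison with holomorphic functions.\<close>

definition moment_fps :: "('a \<Rightarrow> real) \<Rightarrow> complex fps" where
  "moment_fps X = Abs_fps (\<lambda>n. of_real (expectation (\<lambda>x. X x ^ n)) / fact n)"

lemma moment_fps_nth: "fps_nth (moment_fps X) n = of_real (expectation (\<lambda>x. X x ^ n)) / fact n"
  by (simp add: moment_fps_def)

lemma moment_fps_nth_0 [simp]: "fps_nth (moment_fps X) 0 = 1"
  by (simp add: moment_fps_nth prob_space)

lemma all_moments_integrable_mult:
  assumes X: "all_moments X" and Y: "all_moments Y"
  shows "integrable M (\<lambda>x. X x ^ p * Y x ^ q)"
proof (rule Bochner_Integration.integrable_bound)
  have [measurable]: "random_variable borel X" "random_variable borel Y"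
    using X Y by (auto simp: all_moments_def)
  show "integrable M (\<lambda>x. X x ^ (2 * p) + Y x ^ (2 * q))"
    using X Y by (auto simp: all_moments_def)
  show "AE x in M. norm (X x ^ p * Y x ^ q) \<le> norm (X x ^ (2 * p) + Y x ^ (2 * q))"
    by (intro AE_I2) (simp only: real_norm_def power_mult mult.commute[of 2] abs_mult_le_sum_squares)
  show "random_variable borel (\<lambda>x. X x ^ p * Y x ^ q)" by measurable
qed

lemma all_moments_add:
  assumes X: "all_moments X" and Y: "all_moments Y"
  shows "all_moments (\<lambda>x. X x + Y x)"
proof -
  have "random_variable borel (\<lambda>x. X x + Y x)"
    using X Y by (auto simp: all_moments_def)
  moreover have "integrable M (\<lambda>x. (X x + Y x) ^ n)" for n
    unfolding binomial_ring
    by (simp only: mult.assoc) (intro Bochner_Integration.integrable_sum integrable_mult_right all_moments_integrable_mult assms)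
  ultimately show ?thesis by (simp add: all_moments_def)
qed

lemma all_moments_cmult: "all_moments X \<Longrightarrow> all_moments (\<lambda>x. c * X x)"
  by (auto simp: all_moments_def power_mult_distrib)

lemma all_moments_sum:
  "(\<And>k. k \<in> K \<Longrightarrow> all_moments (X k)) \<Longrightarrow> all_moments (\<lambda>x. \<Sum>k\<in>K. X k x)"
proof (induction K rule: infinite_finite_induct)
  case (insert k K)
  then show ?case by (simp add: all_moments_add)
qed (simp_all add: all_moments_def power_0_left)

text \<open>After division by n! the binomial expansion is a Cauchy product. Factorisation of mixed
  moments stands in for independence, because for the combinations of shared noises that is what the
  local argument yields.\<close>

lemma moment_fps_add:
  assumes X: "all_moments X" and Y: "all_moments Y"
    and prod: "\<And>p q. expectation (\<lambda>x. X x ^ p * Y x ^ q) = expectation (\<lambda>x. X x ^ p) * expectation (\<lambda>x. Y x ^ q)"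
  shows "moment_fps (\<lambda>x. X x + Y x) = moment_fps X * moment_fps Y"
proof (rule fps_ext)
  fix n
  have "expectation (\<lambda>x. (X x + Y x) ^ n) = (\<Sum>k\<le>n. real (n choose k) * (expectation (\<lambda>x. X x ^ k) * expectation (\<lambda>x. Y x ^ (n - k))))"
    unfolding binomial_ring prod[symmetric]
    by (simp add: mult.assoc all_moments_integrable_mult[OF X Y])
  then have "fps_nth (moment_fps (\<lambda>x. X x + Y x)) n =
    (\<Sum>k\<le>n. of_nat (n choose k) * (of_real (expectation (\<lambda>x. X x ^ k)) * of_real (expectation (\<lambda>x. Y x ^ (n - k)))) / fact n)"
    by (simp add: moment_fps_nth sum_divide_distrib)
  also have "\<dots> = (\<Sum>k\<le>n. of_real (expectation (\<lambda>x. X x ^ k)) / fact k * (of_real (expectation (\<lambda>x. Y x ^ (n - k))) / fact (n - k)))"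
    by (intro sum.cong refl) (simp add: binomial_fact field_simps)
  finally show "fps_nth (moment_fps (\<lambda>x. X x + Y x)) n = fps_nth (moment_fps X * moment_fps Y) n"
    by (simp add: fps_mult_nth moment_fps_nth atLeast0AtMost)
qed

lemma moment_fps_cmult: "moment_fps (\<lambda>x. c * X x) = fps_scale (of_real c) (moment_fps X)"
  by (rule fps_ext) (simp add: moment_fps_nth power_mult_distrib)

lemma indep_var_expectation_power:
  assumes "indep_var borel X borel Y" "all_moments X" "all_moments Y"
  shows "expectation (\<lambda>x. X x ^ p * Y x ^ q) = expectation (\<lambda>x. X x ^ p) * expectation (\<lambda>x. Y x ^ q)"
proof (rule indep_var_lebesgue_integral)
  show "indep_var borel (\<lambda>x. X x ^ p) borel (\<lambda>x. Y x ^ q)"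
    using indep_var_compose[OF assms(1), of "\<lambda>x. x ^ p" borel "\<lambda>x. x ^ q" borel]
    by (simp add: o_def)
qed (use assms in \<open>auto simp: all_moments_def\<close>)

lemma indep_vars_linear_combination:
  fixes \<epsilon> :: "'i \<Rightarrow> 'a \<Rightarrow> real"
  assumes "finite K" "k \<notin> K" "indep_vars (\<lambda>_. borel) \<epsilon> (insert k K)"
  shows "indep_var borel (\<lambda>x. c k * \<epsilon> k x) borel (\<lambda>x. \<Sum>j\<in>K. c j * \<epsilon> j x)"
  using assms
  by (intro indep_vars_sum[where X="\<lambda>k x. c k * \<epsilon> k x"] indep_vars_compose2[where Y="\<lambda>k x. c k * x"]) auto

lemma moment_fps_linear_combination:
  fixes \<epsilon> :: "'i \<Rightarrow> 'a \<Rightarrow> real"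
  assumes "finite K" "indep_vars (\<lambda>_. borel) \<epsilon> K" "\<And>k. k \<in> K \<Longrightarrow> all_moments (\<epsilon> k)"
  shows "moment_fps (\<lambda>x. \<Sum>k\<in>K. c k * \<epsilon> k x) = (\<Prod>k\<in>K. fps_scale (of_real (c k)) (moment_fps (\<epsilon> k)))"
  using assms
proof (induction K)
  case empty
  show ?case by (rule fps_ext) (simp add: moment_fps_nth power_0_left prob_space)
next
  case (insert k K)
  have "moment_fps (\<lambda>x. c k * \<epsilon> k x + (\<Sum>k\<in>K. c k * \<epsilon> k x)) =
      moment_fps (\<lambda>x. c k * \<epsilon> k x) * moment_fps (\<lambda>x. \<Sum>k\<in>K. c k * \<epsilon> k x)"
    using insert
    by (intro moment_fps_add indep_var_expectation_power indep_vars_linear_combination all_moments_sum all_moments_cmult) auto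
  then show ?case
    using insert indep_vars_subset[OF insert.prems(1), of K] by (auto simp: moment_fps_cmult)
qed

text \<open>Both signs of \<open>s\<close> together dominate exp(|z| |X|). This bounds every power
  of \<open>X\<close> and every partial sum of exp(zX), so dominated convergence integrates the
  exponential series termwise.\<close>

lemma exp_integrable_imp_moments:
  assumes [measurable]: "random_variable borel X" and int: "\<And>s. integrable M (\<lambda>x. exp (s * X x))"
  shows "all_moments X" and "(\<lambda>n. fps_nth (moment_fps X) n * z ^ n) sums (CLINT x|M. exp (z * of_real (X x)))"
    and "integrable M (\<lambda>x. exp (z * complex_of_real (X x)))"
proof -
  have bound: "exp \<bar>s * X x\<bar> \<le> exp (s * X x) + exp (- s * X x)" for s x
    by (cases "s * X x \<ge> 0") auto
  have int2: "integrable M (\<lambda>x. exp (s * X x) + exp (- s * X x))" for s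
    by (intro Bochner_Integration.integrable_add int)
  have "integrable M (\<lambda>x. X x ^ n)" for n
  proof (rule Bochner_Integration.integrable_bound)
    show "integrable M (\<lambda>x. fact n * (exp (1 * X x) + exp (- 1 * X x)))"
      using int2 by (intro integrable_mult_right)
    have "\<bar>X x\<bar> ^ n \<le> fact n * exp \<bar>X x\<bar>" for x
    proof -
      have "(\<Sum>k\<in>{n}. \<bar>X x\<bar> ^ k /\<^sub>R fact k) \<le> exp \<bar>X x\<bar>"
        unfolding exp_def by (intro sum_le_suminf summable_exp_generic) auto
      then show ?thesis by (simp add: field_simps)
    qed
    moreover have "fact n * exp \<bar>X x\<bar> \<le> fact n * (exp (1 * X x) + exp (- 1 * X x))" for x
      using bound[of 1 x] by (intro mult_left_mono) simp_all
    ultimately have "\<bar>X x\<bar> ^ n \<le> fact n * (exp (1 * X x) + exp (- 1 * X x))" for x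
      using order_trans by blast
    then show "AE x in M. norm (X x ^ n) \<le> norm (fact n * (exp (1 * X x) + exp (- 1 * X x)))"
      by (intro AE_I2) (simp add: power_abs)
  qed measurable
  then show mom: "all_moments X" by (simp add: all_moments_def)
  show int3: "integrable M (\<lambda>x. exp (z * complex_of_real (X x)))"
    by (rule Bochner_Integration.integrable_bound[OF int[of "Re z"]]) auto
  have "(\<lambda>n. CLINT x|M. (\<Sum>k<n. (z * of_real (X x)) ^ k /\<^sub>R fact k)) \<longlonglongrightarrow> (CLINT x|M. exp (z * of_real (X x)))"
  proof (rule integral_dominated_convergence[where w="\<lambda>x. exp (norm z * X x) + exp (- norm z * X x)"])
    show "AE x in M. (\<lambda>n. \<Sum>k<n. (z * of_real (X x)) ^ k /\<^sub>R fact k) \<longlonglongrightarrow> exp (z * of_real (X x))"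
      using exp_converges by (auto simp: sums_def)
    show "AE x in M. norm (\<Sum>k<n. (z * of_real (X x)) ^ k /\<^sub>R fact k) \<le> exp (norm z * X x) + exp (- norm z * X x)" for n
    proof (intro AE_I2)
      fix x
      have "norm (\<Sum>k<n. (z * of_real (X x)) ^ k /\<^sub>R fact k) \<le> (\<Sum>k<n. \<bar>norm z * X x\<bar> ^ k /\<^sub>R fact k)"
        by (rule order_trans[OF norm_sum]) (simp add: norm_power norm_mult abs_mult)
      also have "\<dots> \<le> exp \<bar>norm z * X x\<bar>"
        unfolding exp_def by (intro sum_le_suminf summable_exp_generic) auto
      finally show "norm (\<Sum>k<n. (z * of_real (X x)) ^ k /\<^sub>R fact k) \<le> exp (norm z * X x) + exp (- norm z * X x)"
        using bound[of "norm z" x] by linarith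
    qed
  qed (use int2 in auto)
  moreover have "(CLINT x|M. (\<Sum>k<n. (z * of_real (X x)) ^ k /\<^sub>R fact k)) = (\<Sum>k<n. fps_nth (moment_fps X) k * z ^ k)" for n
  proof -
    have "(\<lambda>x. (z * of_real (X x)) ^ k /\<^sub>R fact k) = (\<lambda>x. (z ^ k / fact k) * of_real (X x ^ k))" for k
      by (auto simp: scaleR_conv_of_real field_simps power_mult_distrib)
    then show ?thesis
      using mom by (simp add: all_moments_def moment_fps_nth mult.commute del: of_real_power)
  qed
  ultimately show "(\<lambda>n. fps_nth (moment_fps X) n * z ^ n) sums (CLINT x|M. exp (z * of_real (X x)))"
    by (simp add: sums_def)
qed

text \<open>Only even terms are summed: for them the absolute moment is the moment itself, which the
  coefficients of the series control. They add up to cosh(sX), and exp(sX) \<le> 2 cosh(sX).\<close>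

lemma moment_fps_entire_imp_exp_integrable:
  assumes X: "all_moments X" and sum: "\<And>z. summable (\<lambda>n. fps_nth (moment_fps X) n * z ^ n)"
  shows "integrable M (\<lambda>x. exp (s * X x))"
proof -
  have [measurable]: "random_variable borel X" using X by (simp add: all_moments_def)
  define h where "h n x = (if even n then (s * X x) ^ n /\<^sub>R fact n else 0)" for n x
  have h: "h n x \<ge> 0" for n x by (simp add: h_def zero_le_even_power)
  have hs: "(\<lambda>n. h n x) sums cosh (s * X x)" for x
    unfolding h_def by (rule cosh_converges)
  have "integrable M (\<lambda>x. \<Sum>n. h n x)"
  proof (rule integrable_suminf)
    show "integrable M (h n)" for n
      using X by (cases "even n") (auto simp: h_def[abs_def] all_moments_def power_mult_distrib)
    show "AE x in M. summable (\<lambda>n. norm (h n x))"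
      using hs h by (auto intro: sums_summable)
    \<comment> \<open>Convergence at the larger radius |s| + 1 gives absolute convergence at
      s.\<close>
    have "summable (\<lambda>n. norm (fps_nth (moment_fps X) n * of_real s ^ n))"
      by (rule powser_insidea[where x="of_real (\<bar>s\<bar> + 1)"]) (use sum in auto)
    then show "summable (\<lambda>n. \<integral>x. norm (h n x) \<partial>M)"
    proof (rule summable_comparison_test_ev[rotated])
      have "norm (\<integral>x. norm (h n x) \<partial>M) \<le> norm (fps_nth (moment_fps X) n * of_real s ^ n)" for n
      proof (cases "even n")
        case True
        then have "(\<integral>x. norm (h n x) \<partial>M) = s ^ n / fact n * expectation (\<lambda>x. X x ^ n)"
          using h by (simp only: real_norm_def abs_of_nonneg) (simp add: h_def power_mult_distrib field_simps)
        then show ?thesis by (simp add: moment_fps_nth norm_mult norm_divide norm_power abs_mult power_abs mult.commute)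
      qed (simp add: h_def)
      then show "\<forall>\<^sub>F n in sequentially. norm (\<integral>x. norm (h n x) \<partial>M) \<le> norm (fps_nth (moment_fps X) n * of_real s ^ n)"
        by simp
    qed
  qed
  then have "integrable M (\<lambda>x. 2 * cosh (s * X x))"
    using hs by (simp add: sums_iff)
  then show ?thesis
    by (rule Bochner_Integration.integrable_bound) (auto simp: cosh_def)
qed

text \<open>The product rule for extended nonnegative integrals presupposes no integrability, so
  integrability can be deduced from it.\<close>

lemma indep_var_nn_integral:
  assumes "indep_var borel X borel Y" and [measurable]: "f \<in> borel_measurable borel" "g \<in> borel_measurable borel"
  shows "(\<integral>\<^sup>+x. f (X x) * g (Y x) \<partial>M) = (\<integral>\<^sup>+x. f (X x) \<partial>M) * (\<integral>\<^sup>+x. g (Y x) \<partial>M)"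
proof -
  have "indep_var borel (\<lambda>x. f (X x)) borel (\<lambda>x. g (Y x))"
    using indep_var_compose[OF assms] by (simp add: o_def)
  moreover have "(\<lambda>_::bool. borel :: ennreal measure) = case_bool borel borel"
    by (rule ext) (metis (full_types) bool.case(1) bool.case(2))
  ultimately have "indep_vars (\<lambda>_. borel) (case_bool (\<lambda>x. f (X x)) (\<lambda>x. g (Y x))) UNIV"
    by (simp add: indep_var_def)
  then have "(\<integral>\<^sup>+x. (\<Prod>i\<in>UNIV. case_bool (\<lambda>x. f (X x)) (\<lambda>x. g (Y x)) i x) \<partial>M) =
      (\<Prod>i\<in>UNIV. \<integral>\<^sup>+x. case_bool (\<lambda>x. f (X x)) (\<lambda>x. g (Y x)) i x \<partial>M)"
    by (intro indep_vars_nn_integral) auto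
  then show ?thesis by (simp add: UNIV_bool mult.commute)
qed

text \<open>If a product of extended expectations is finite and its second factor is nonzero, the
  first is finite. This passes exponential integrability from a sum to its summands and removes the
  indicator of an independent event.\<close>

lemma integrable_factor_of_indep:
  fixes f g :: "real \<Rightarrow> real"
  assumes indep: "indep_var borel X borel Y"
    and [measurable]: "f \<in> borel_measurable borel" "g \<in> borel_measurable borel"
    and nonneg: "\<And>x. f x \<ge> 0" "\<And>x. g x \<ge> 0"
    and int: "integrable M (\<lambda>x. f (X x) * g (Y x))"
    and nz: "\<not> (AE x in M. g (Y x) = 0)"
  shows "integrable M (\<lambda>x. f (X x))"
proof -
  have [measurable]: "random_variable borel X" "random_variable borel Y"
    using indep indep_var_rv1 indep_var_rv2 by blast+
  have "(\<integral>\<^sup>+x. ennreal (f (X x)) \<partial>M) * (\<integral>\<^sup>+x. ennreal (g (Y x)) \<partial>M) = (\<integral>\<^sup>+x. ennreal (f (X x) * g (Y x)) \<partial>M)"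
    using indep_var_nn_integral[OF indep, of "\<lambda>x. ennreal (f x)" "\<lambda>x. ennreal (g x)"] nonneg
    by (simp add: ennreal_mult)
  also have "\<dots> < \<infinity>"
    using int nonneg by (simp add: integrable_iff_bounded)
  finally have "(\<integral>\<^sup>+x. ennreal (f (X x)) \<partial>M) * (\<integral>\<^sup>+x. ennreal (g (Y x)) \<partial>M) < \<infinity>" .
  moreover have "(\<integral>\<^sup>+x. ennreal (g (Y x)) \<partial>M) \<noteq> 0"
    using nz nonneg by (simp add: nn_integral_0_iff_AE antisym_conv ennreal_eq_0_iff)
  ultimately have "(\<integral>\<^sup>+x. ennreal (f (X x)) \<partial>M) < \<infinity>"
    by (auto simp: ennreal_mult_less_top less_top)
  then show ?thesis
    using nonneg by (simp add: integrable_iff_bounded)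
qed

end

section \<open>Summands of a variable with a polynomial cumulant series\<close>

lemma poly_norm_bound:
  fixes p :: "complex poly"
  shows "norm (poly p z) \<le> (\<Sum>i\<le>degree p. norm (coeff p i)) * (1 + norm z) ^ degree p"
proof -
  have "norm (poly p z) \<le> (\<Sum>i\<le>degree p. norm (coeff p i) * norm z ^ i)"
    unfolding poly_altdef by (rule order_trans[OF norm_sum]) (simp add: norm_mult norm_power)
  also have "\<dots> \<le> (\<Sum>i\<le>degree p. norm (coeff p i) * (1 + norm z) ^ degree p)"
  proof (intro sum_mono mult_left_mono)
    fix i assume "i \<in> {..degree p}"
    then have "norm z ^ i \<le> (1 + norm z) ^ i" "(1 + norm z) ^ i \<le> (1 + norm z) ^ degree p"
      by (auto intro!: power_mono power_increasing)
    then show "norm z ^ i \<le> (1 + norm z) ^ degree p" by linarith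
  qed simp
  finally show ?thesis by (simp add: sum_distrib_right)
qed

section \<open>Laplace transforms of independent summands\<close>

context prob_space
begin

lemma indep_var_sym: "indep_var S X T Y \<Longrightarrow> indep_var T Y S X"
proof -
  have "indep_set B A" if "indep_set A B" for A B
  proof -
    have "prob (a \<inter> b) = prob a * prob b" if "a \<in> B" "b \<in> A" for a b
      using \<open>indep_set A B\<close> that unfolding indep_sets2_eq by (simp add: Int_commute[of a] mult.commute[of "prob a"])
    then show ?thesis using that by (simp add: indep_sets2_eq)
  qed
  then show "indep_var S X T Y \<Longrightarrow> indep_var T Y S X" by (auto simp: indep_var_eq)
qed

text \<open>Convexity: 1 + u \<le> exp u, and the linear term has mean zero.\<close>

lemma one_le_expectation_exp:
  fixes X :: "'a \<Rightarrow> real"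
  assumes "integrable M X" "expectation X = 0" "integrable M (\<lambda>x. exp (s * X x))"
  shows "1 \<le> expectation (\<lambda>x. exp (s * X x))"
proof -
  have "expectation (\<lambda>x. 1 + s * X x) \<le> expectation (\<lambda>x. exp (s * X x))"
    by (rule Bochner_Integration.integral_mono) (use assms in auto)
  then show ?thesis using assms by (simp add: prob_space)
qed

lemma norm_expectation_exp_le:
  "norm (CLINT x|M. exp (z * complex_of_real (X x))) \<le> expectation (\<lambda>x. exp (Re z * X x))"
  by (rule order_trans[OF integral_norm_bound]) simp

lemma expectation_exp_of_real:
  "(CLINT x|M. exp (of_real s * complex_of_real (X x))) = of_real (expectation (\<lambda>x. exp (s * X x)))"
proof -
  have "exp (of_real s * complex_of_real (X x)) = of_real (exp (s * X x))" for x
    by (simp flip: exp_of_real)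
  then show ?thesis by simp
qed

text \<open>The theorems of Marcinkiewicz and Cramer in one step: \<open>X + R\<close> need not be shown
  Gaussian first, since \<open>1 \<le> E[exp(sR)]\<close> carries its growth bound over to \<open>X\<close>.\<close>

lemma char_of_summand:
  assumes indep: "indep_var borel X borel R"
    and X: "integrable M X" "expectation X = 0"
    and R: "integrable M R" "expectation R = 0"
    and S: "all_moments (\<lambda>x. X x + R x)"
    and q: "log_deriv (moment_fps (\<lambda>x. X x + R x)) = fps_of_poly q"
  shows "(CLINT x|M. iexp (t * X x)) = exp (of_real (- expectation (\<lambda>x. (X x)\<^sup>2) * t\<^sup>2 / 2))"
proof -
  define S where "S = (\<lambda>x. X x + R x)"
  define m where "m V z = (CLINT x|M. exp (z * complex_of_real (V x)))" for V z
  have [measurable]: "random_variable borel X" "random_variable borel R"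
    using X R by auto
  have S_meas: "random_variable borel S" by (simp add: S_def)
  have inv: "inverse (moment_fps S) * moment_fps S = 1"
    by (simp add: inverse_mult_eq_1)
  \<comment> \<open>The hypothesis on the logarithmic derivative is a linear differential equation
    for the moment series, whose solution is exp Q.\<close>
  then have "fps_deriv (moment_fps S) = fps_of_poly q * moment_fps S"
    unfolding q[folded S_def, symmetric] by (simp add: log_deriv_def mult.assoc)
  then obtain Q where Q: "\<And>z. (\<lambda>n. fps_nth (moment_fps S) n * z ^ n) sums exp (poly Q z)"
    using sums_exp_poly_of_log_deriv moment_fps_nth_0 by blast
  have int_S: "integrable M (\<lambda>x. exp (s * S x))" for s
    by (rule moment_fps_entire_imp_exp_integrable) (use S Q sums_summable in \<open>auto simp: S_def\<close>)
  have mS: "m S z = exp (poly Q z)" for z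
    using exp_integrable_imp_moments(2)[OF S_meas int_S, of z] Q[of z] sums_unique2
    unfolding m_def by blast
  \<comment> \<open>exp(sS) is a product of positive functions of the independent summands, so its
    integrability passes to each of them.\<close>
  have factor: "integrable M (\<lambda>x. exp (s * V x))"
    if "indep_var borel V borel W" "\<And>x. S x = V x + W x" for s V W
    by (rule integrable_factor_of_indep[OF that(1), of "\<lambda>v. exp (s * v)" "\<lambda>v. exp (s * v)"])
      (use int_S[of s] in \<open>simp_all add: that(2) distrib_left flip: exp_add\<close>)
  have int_X: "integrable M (\<lambda>x. exp (s * X x))" for s
    by (rule factor[OF indep]) (simp add: S_def)
  have int_R: "integrable M (\<lambda>x. exp (s * R x))" for s
    by (rule factor[OF indep_var_sym[OF indep]]) (simp add: S_def)
  note X_exp = exp_integrable_imp_moments[OF \<open>random_variable borel X\<close> int_X]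
  note R_exp = exp_integrable_imp_moments[OF \<open>random_variable borel R\<close> int_R]
  have mult: "m X z * m R z = m S z" for z
  proof -
    have "indep_var borel (\<lambda>x. exp (z * complex_of_real (X x))) borel (\<lambda>x. exp (z * complex_of_real (R x)))"
      using indep_var_compose[OF indep, of "\<lambda>x. exp (z * complex_of_real x)" borel "\<lambda>x. exp (z * complex_of_real x)" borel]
      by (simp add: o_def)
    from indep_var_lebesgue_integral[OF this X_exp(3) R_exp(3)] show ?thesis
      by (simp add: m_def S_def distrib_left exp_add)
  qed
  \<comment> \<open>A factor of the zero-free function exp Q has no zeros, which provides the entire
    logarithm \<open>H\<close>.\<close>
  have mX_nz: "m X z \<noteq> 0" for z using mult[of z] mS[of z] by auto
  have sums_X: "(\<lambda>n. fps_nth (moment_fps X) n * z ^ n) sums m X z" for z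
    using X_exp(2) unfolding m_def .
  have "m X holomorphic_on ball 0 r" for r
    by (rule power_series_holomorphic[where a="fps_nth (moment_fps X)"]) (use sums_X in simp)
  then have "m X field_differentiable at z" for z
    by (meson centre_in_ball dist_0_norm gt_ex holomorphic_on_imp_differentiable_at mem_ball open_ball)
  then have mX_hol: "m X holomorphic_on UNIV"
    by (simp add: holomorphic_on_def field_differentiable_at_within)
  obtain H where H: "H holomorphic_on UNIV" "\<And>z. exp (H z) = m X z"
    using holomorphic_logarithm_exists[OF convex_UNIV open_UNIV mX_hol mX_nz UNIV_I] by auto
  have exp_Re_H: "exp (Re (H z)) = norm (m X z)" for z
    using H(2)[of z] norm_exp_eq_Re[of "H z"] by simp
  have ridge: "norm (m X z) \<le> norm (m X (of_real (Re z)))" for z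
  proof -
    have "norm (m X z) \<le> expectation (\<lambda>x. exp (Re z * X x))"
      unfolding m_def by (rule norm_expectation_exp_le)
    also have "\<dots> \<le> norm (m X (of_real (Re z)))"
      unfolding m_def expectation_exp_of_real by simp
    finally show ?thesis .
  qed
  \<comment> \<open>With s = Re z, the ridge inequality and E[exp(sR)] \<ge> 1 give |m X z| \<le> m
    X s \<le> m S s = exp(Re Q(s)), so Re H inherits the polynomial growth bound of Q.\<close>
  have "Re (H z) \<le> (\<Sum>i\<le>degree Q. norm (coeff Q i)) * (1 + norm z) ^ degree Q" for z
  proof -
    have "exp (Re (H z)) \<le> norm (m X (of_real (Re z))) * 1"
      using ridge[of z] exp_Re_H by simp
    also have "\<dots> \<le> norm (m X (of_real (Re z))) * norm (m R (of_real (Re z)))"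
      using one_le_expectation_exp[OF R int_R, of "Re z"]
      by (intro mult_left_mono) (simp_all add: m_def expectation_exp_of_real)
    also have "\<dots> = exp (Re (poly Q (of_real (Re z))))"
      unfolding norm_mult[symmetric] mult mS norm_exp_eq_Re ..
    finally have "Re (H z) \<le> Re (poly Q (of_real (Re z)))" by simp
    also have "\<dots> \<le> norm (poly Q (of_real (Re z)))" by (rule complex_Re_le_cmod)
    also have "\<dots> \<le> (\<Sum>i\<le>degree Q. norm (coeff Q i)) * (1 + norm (complex_of_real (Re z))) ^ degree Q"
      by (rule poly_norm_bound)
    also have "\<dots> \<le> (\<Sum>i\<le>degree Q. norm (coeff Q i)) * (1 + norm z) ^ degree Q"
      using abs_Re_le_cmod[of z] by (intro mult_left_mono power_mono sum_nonneg) auto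
    finally show ?thesis .
  qed
  then obtain p where p: "\<And>z. H z = poly p z"
    using entire_Re_bound_imp_poly[OF H(1)] by (metis norm_ge_zero sum_nonneg)
  have deg: "degree p \<le> 2"
  proof (rule ridge_poly_degree_le_2)
    fix z
    have "exp (Re (H z)) \<le> exp (Re (H (of_real (Re z))))"
      unfolding exp_Re_H by (rule ridge)
    then show "Re (poly p z) \<le> Re (poly p (of_real (Re z)))" by (simp add: p)
  qed
  have fps: "m X has_fps_expansion moment_fps X"
    by (rule has_fps_expansionI) (use sums_X in simp)
  have mX: "m X z = exp (poly p z)" for z using H(2) p by simp
  have "(m X has_field_derivative poly (pderiv p) z * m X z) (at z)" for z
    unfolding mX by (auto intro!: derivative_eq_intros poly_DERIV)
  then have "deriv (m X) = (\<lambda>z. poly (pderiv p) z * m X z)"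
    using DERIV_imp_deriv by blast
  then have "(\<lambda>z. poly (pderiv p) z * m X z) has_fps_expansion fps_deriv (moment_fps X)"
    using has_fps_expansion_deriv[OF fps] by simp
  moreover have "(\<lambda>z. poly (pderiv p) z * m X z) has_fps_expansion fps_of_poly (pderiv p) * moment_fps X"
    by (intro has_fps_expansion_mult fps) (simp add: has_fps_expansion_def)
  ultimately have ode: "fps_deriv (moment_fps X) = fps_of_poly (pderiv p) * moment_fps X"
    using fps_expansion_unique_complex by blast
  \<comment> \<open>The first two coefficients of the differential equation identify the linear
    coefficient of \<open>p\<close> with the mean and the quadratic one with half the second
    moment.\<close>
  have "fps_nth (fps_deriv (moment_fps X)) 0 = coeff p 1"
    unfolding ode by (simp add: coeff_pderiv)
  then have c1: "coeff p 1 = 0" using X by (simp add: moment_fps_nth)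
  have "fps_nth (fps_deriv (moment_fps X)) 1 = 2 * coeff p 2"
    unfolding ode using c1 by (simp add: fps_mult_nth coeff_pderiv numeral_2_eq_2)
  then have c2: "2 * coeff p 2 = of_real (expectation (\<lambda>x. (X x)\<^sup>2))"
    by (simp add: moment_fps_nth numeral_2_eq_2)
  have "poly p z = coeff p 0 + coeff p 1 * z + coeff p 2 * z\<^sup>2" for z
  proof -
    have "poly p z = (\<Sum>i\<le>2. coeff p i * z ^ i)"
      unfolding poly_altdef using deg
      by (intro sum.mono_neutral_left) (auto simp: coeff_eq_0)
    then show ?thesis by (simp add: numeral_2_eq_2)
  qed
  then have poly: "poly p z = coeff p 0 + coeff p 2 * z\<^sup>2" for z using c1 by simp
  \<comment> \<open>A logarithm is determined only up to multiples of 2 pi i, so the exponential of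
    the constant term is evaluated and not the term itself.\<close>
  have "exp (coeff p 0) = 1" using mX[of 0] poly[of 0] by (simp add: m_def prob_space)
  then have "m X (\<i> * of_real t) = exp (coeff p 2 * (\<i> * of_real t)\<^sup>2)"
    unfolding mX poly exp_add by simp
  also have "coeff p 2 * (\<i> * of_real t)\<^sup>2 = of_real (- expectation (\<lambda>x. (X x)\<^sup>2) * t\<^sup>2 / 2)"
  proof -
    have "coeff p 2 = of_real (expectation (\<lambda>x. (X x)\<^sup>2)) / 2"
      using c2 by (simp add: eq_divide_eq mult.commute)
    then show ?thesis by (simp add: power_mult_distrib)
  qed
  finally show ?thesis by (simp add: m_def mult.assoc)
qed

text \<open>Division by \<sigma> = sqrt v gives the characteristic function of the standard normal
  law. Levy's uniqueness theorem identifies the law, and an affine map returns to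
  \<open>X\<close>.\<close>

lemma gaussian_of_char:
  assumes [measurable]: "random_variable borel X" and "v > 0"
    and char: "\<And>t. (CLINT x|M. iexp (t * X x)) = exp (of_real (- v * t\<^sup>2 / 2))"
  shows "\<exists>\<sigma>>0. distributed M lborel X (normal_density 0 \<sigma>)"
proof -
  define \<sigma> where "\<sigma> = sqrt v"
  have \<sigma>: "\<sigma> > 0" "\<sigma>\<^sup>2 = v" using \<open>v > 0\<close> by (simp_all add: \<sigma>_def)
  define Y where "Y x = X x / \<sigma>" for x
  have [measurable]: "random_variable borel Y" by (simp add: Y_def[abs_def])
  interpret D: real_distribution "distr M borel Y"
    by (rule real_distribution_distr) measurable
  have "char (distr M borel Y) t = char std_normal_distribution t" for t
  proof -
    have "char (distr M borel Y) t = (CLINT x|M. iexp ((t / \<sigma>) * X x))"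
      by (simp add: char_def integral_distr Y_def)
    also have "\<dots> = of_real (exp (- (t\<^sup>2) / 2))"
      unfolding char using \<sigma> by (auto simp: power_divide simp flip: exp_of_real)
    finally show ?thesis by (simp add: char_std_normal_distribution)
  qed
  then have "distr M borel Y = std_normal_distribution"
    by (intro Levy_uniqueness D.real_distribution_axioms real_dist_normal_dist) auto
  then have "distr M lborel Y = density lborel (\<lambda>x. ennreal (std_normal_density x))"
    by (metis distr_cong sets_lborel)
  then have "distributed M lborel Y (\<lambda>x. ennreal (std_normal_density x))"
    by (simp add: distributed_def)
  from normal_density_affine[OF this, of \<sigma> 0] \<sigma> have "distributed M lborel X (normal_density 0 \<sigma>)"
    by (simp add: Y_def)
  then show ?thesis using \<sigma> by blast
qed

end

section \<open>Variables with locally factorising characteristic function\<close>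

text \<open>Euler's formula and the binomial theorem. All frequencies lie between -p and p, so those
  of sin(hx)^p shrink with h.\<close>

lemma sin_power_trig_poly:
  "\<exists>c. \<forall>x. complex_of_real (sin x ^ p) = (\<Sum>j\<le>p. c j * iexp ((real j - real (p - j)) * x))"
proof (intro exI allI)
  fix x
  have "complex_of_real (sin x ^ p) = ((iexp x + - iexp (- x)) / (2 * \<i>)) ^ p"
    by (simp add: sin_exp_eq flip: sin_of_real)
  also have "\<dots> = (\<Sum>j\<le>p. of_nat (p choose j) * iexp x ^ j * (- iexp (- x)) ^ (p - j)) / (2 * \<i>) ^ p"
    by (simp only: power_divide binomial_ring)
  also have "\<dots> = (\<Sum>j\<le>p. (of_nat (p choose j) * (- 1) ^ (p - j) / (2 * \<i>) ^ p) * iexp ((real j - real (p - j)) * x))"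
    unfolding sum_divide_distrib
  proof (intro sum.cong refl)
    fix j
    have "iexp ((real j - real (p - j)) * x) = iexp x ^ j * iexp (- x) ^ (p - j)"
      by (simp add: algebra_simps flip: exp_of_nat_mult exp_add)
    moreover have "(- iexp (- x)) ^ (p - j) = (- 1) ^ (p - j) * iexp (- x) ^ (p - j)"
      by (rule power_minus)
    ultimately show "of_nat (p choose j) * iexp x ^ j * (- iexp (- x)) ^ (p - j) / (2 * \<i>) ^ p =
        (of_nat (p choose j) * (- 1) ^ (p - j) / (2 * \<i>) ^ p) * iexp ((real j - real (p - j)) * x)"
      by simp
  qed
  finally show "complex_of_real (sin x ^ p) = (\<Sum>j\<le>p. (of_nat (p choose j) * (- 1) ^ (p - j) / (2 * \<i>) ^ p) * iexp ((real j - real (p - j)) * x))" .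
qed

text \<open>The functions sin(hx)/h with h = 1/(n+1) act as truncations of x: they are bounded by n
  + 1 and by |x|, converge to x, and their powers involve only small frequencies.\<close>

lemma sin_scaled_tendsto:
  "(\<lambda>n. sin (inverse (real (Suc n)) * x) / inverse (real (Suc n))) \<longlonglongrightarrow> x"
proof -
  have "((\<lambda>h. sin (h * x)) has_real_derivative x) (at 0)"
    by (auto intro!: derivative_eq_intros)
  then have "((\<lambda>h. sin (h * x) / h) \<longlongrightarrow> x) (at 0)"
    by (simp add: DERIV_def)
  moreover have "filterlim (\<lambda>n. inverse (real (Suc n))) (at 0) sequentially"
    using LIMSEQ_inverse_real_of_nat by (simp add: filterlim_at)
  ultimately show ?thesis by (rule filterlim_compose)
qed

lemma abs_sin_scaled_le: "(h::real) > 0 \<Longrightarrow> \<bar>sin (h * x) / h\<bar> \<le> \<bar>x\<bar>"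
  using abs_sin_x_le_abs_x[of "h * x"] by (simp add: abs_mult divide_le_eq mult.commute)

section \<open>Moments under local factorisation\<close>

context prob_space
begin

text \<open>Factorisation is asked for only on a square around 0, since the factors cancelled to
  obtain it are known to be nonzero only near 0.\<close>

definition locally_independent :: "('a \<Rightarrow> real) \<Rightarrow> ('a \<Rightarrow> real) \<Rightarrow> bool" where
  "locally_independent U V \<longleftrightarrow> random_variable borel U \<and> random_variable borel V \<and>
    (\<exists>\<delta>>0. \<forall>t s. \<bar>t\<bar> < \<delta> \<longrightarrow> \<bar>s\<bar> < \<delta> \<longrightarrow>
      (CLINT x|M. iexp (t * U x) * iexp (s * V x)) = (CLINT x|M. iexp (t * U x)) * (CLINT x|M. iexp (s * V x)))"

lemma integrable_iexp_real: "random_variable borel U \<Longrightarrow> integrable M (\<lambda>x. iexp (t * U x))"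
  by (rule integrable_const_bound[where B=1]) auto

text \<open>Both powers are expanded as trigonometric polynomials. Once (p + q) h < \<delta>, every
  frequency lies where the joint characteristic function factorises, and the double sum
  splits.\<close>

lemma expectation_sin_power_mult:
  assumes "locally_independent U V"
  shows "\<forall>\<^sub>F n in sequentially.
    expectation (\<lambda>x. (sin (inverse (real (Suc n)) * U x) / inverse (real (Suc n))) ^ p * (sin (inverse (real (Suc n)) * V x) / inverse (real (Suc n))) ^ q) =
    expectation (\<lambda>x. (sin (inverse (real (Suc n)) * U x) / inverse (real (Suc n))) ^ p) *
    expectation (\<lambda>x. (sin (inverse (real (Suc n)) * V x) / inverse (real (Suc n))) ^ q)"
proof -
  have [measurable]: "random_variable borel U" "random_variable borel V"
    using assms by (auto simp: locally_independent_def)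
  obtain \<delta> where \<delta>: "\<delta> > 0" and eq: "\<And>t s. \<bar>t\<bar> < \<delta> \<Longrightarrow> \<bar>s\<bar> < \<delta> \<Longrightarrow>
      (CLINT x|M. iexp (t * U x) * iexp (s * V x)) = (CLINT x|M. iexp (t * U x)) * (CLINT x|M. iexp (s * V x))"
    using assms unfolding locally_independent_def by blast
  have "(\<lambda>n. real (p + q) * inverse (real (Suc n))) \<longlonglongrightarrow> real (p + q) * 0"
    by (intro tendsto_mult tendsto_const LIMSEQ_inverse_real_of_nat)
  then have "\<forall>\<^sub>F n in sequentially. real (p + q) * inverse (real (Suc n)) < \<delta>"
    using \<delta> by (simp add: order_tendsto_iff)
  then show ?thesis
  proof eventually_elim
    case (elim n)
    define h where "h = inverse (real (Suc n))"
    have h: "h > 0" "real (p + q) * h < \<delta>" using elim by (simp_all add: h_def)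
    obtain c d where
      c: "\<And>x. complex_of_real (sin x ^ p) = (\<Sum>j\<le>p. c j * iexp ((real j - real (p - j)) * x))" and
      d: "\<And>x. complex_of_real (sin x ^ q) = (\<Sum>j\<le>q. d j * iexp ((real j - real (q - j)) * x))"
      using sin_power_trig_poly[of p] sin_power_trig_poly[of q] by blast
    define r where "r m j = (real j - real (m - j)) * h" for m j
    have r: "\<bar>r m j\<bar> < \<delta>" if "j \<le> m" "m \<le> p + q" for m j
    proof -
      have "\<bar>real j - real (m - j)\<bar> \<le> real (p + q)" using that by linarith
      then have "\<bar>r m j\<bar> \<le> real (p + q) * h"
        using h unfolding r_def abs_mult by (intro mult_mono) auto
      with h show ?thesis by linarith
    qed
    have cU: "complex_of_real (sin (h * U x) ^ p) = (\<Sum>j\<le>p. c j * iexp (r p j * U x))" for x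
      unfolding c by (simp add: r_def mult.assoc)
    have dV: "complex_of_real (sin (h * V x) ^ q) = (\<Sum>j\<le>q. d j * iexp (r q j * V x))" for x
      unfolding d by (simp add: r_def mult.assoc)
    have int: "integrable M (\<lambda>x. iexp (t * U x) * iexp (s * V x))" for t s
      by (rule integrable_const_bound[where B=1]) (auto simp: norm_mult)
    have "complex_of_real (expectation (\<lambda>x. sin (h * U x) ^ p * sin (h * V x) ^ q)) =
        (CLINT x|M. complex_of_real (sin (h * U x) ^ p) * complex_of_real (sin (h * V x) ^ q))"
      by (simp only: integral_complex_of_real flip: of_real_mult)
    also have "\<dots> = (CLINT x|M. (\<Sum>j\<le>p. \<Sum>k\<le>q. (c j * d k) * (iexp (r p j * U x) * iexp (r q k * V x))))"
      unfolding cU dV sum_product by (simp add: algebra_simps)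
    also have "\<dots> = (\<Sum>j\<le>p. \<Sum>k\<le>q. (c j * d k) * (CLINT x|M. iexp (r p j * U x) * iexp (r q k * V x)))"
      by (simp only: Bochner_Integration.integral_sum Bochner_Integration.integrable_sum integrable_mult_right int integral_mult_right_zero)
    also have "\<dots> = (\<Sum>j\<le>p. \<Sum>k\<le>q. (c j * d k) * ((CLINT x|M. iexp (r p j * U x)) * (CLINT x|M. iexp (r q k * V x))))"
      by (intro sum.cong refl arg_cong2[where f="(*)"] eq r) auto
    also have "\<dots> = (\<Sum>j\<le>p. c j * (CLINT x|M. iexp (r p j * U x))) * (\<Sum>k\<le>q. d k * (CLINT x|M. iexp (r q k * V x)))"
      unfolding sum_product by (simp add: algebra_simps)
    also have "(\<Sum>j\<le>p. c j * (CLINT x|M. iexp (r p j * U x))) = (CLINT x|M. complex_of_real (sin (h * U x) ^ p))"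
      unfolding cU by (simp only: Bochner_Integration.integral_sum integrable_mult_right integrable_iexp_real integral_mult_right_zero \<open>random_variable borel U\<close>)
    also have "(\<Sum>k\<le>q. d k * (CLINT x|M. iexp (r q k * V x))) = (CLINT x|M. complex_of_real (sin (h * V x) ^ q))"
      unfolding dV by (simp only: Bochner_Integration.integral_sum integrable_mult_right integrable_iexp_real integral_mult_right_zero \<open>random_variable borel V\<close>)
    also have "(CLINT x|M. complex_of_real (sin (h * U x) ^ p)) * (CLINT x|M. complex_of_real (sin (h * V x) ^ q)) =
        complex_of_real (expectation (\<lambda>x. sin (h * U x) ^ p) * expectation (\<lambda>x. sin (h * V x) ^ q))"
      by (simp only: integral_complex_of_real of_real_mult)
    finally have "expectation (\<lambda>x. sin (h * U x) ^ p * sin (h * V x) ^ q) =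
        expectation (\<lambda>x. sin (h * U x) ^ p) * expectation (\<lambda>x. sin (h * V x) ^ q)"
      by (simp only: of_real_eq_iff)
    then show ?case
      unfolding h_def[symmetric] by (simp add: power_divide)
  qed
qed

text \<open>Fatou's lemma along the truncations: for even n, E[u^n v^n] = E[u^n] E[v^n] \<le> E[U^n]
  E[V^n] as soon as m is large. U^n V^n has degree 2n in the noises, which is the source of the
  moment doubling.\<close>

lemma locally_independent_integrable_mult:
  assumes loc: "locally_independent U V" and "even n"
    and int: "integrable M (\<lambda>x. U x ^ n)" "integrable M (\<lambda>x. V x ^ n)"
  shows "integrable M (\<lambda>x. U x ^ n * V x ^ n)"
proof -
  have [measurable]: "random_variable borel U" "random_variable borel V"
    using loc by (auto simp: locally_independent_def)
  define u where "u m x = sin (inverse (real (Suc m)) * U x) / inverse (real (Suc m))" for m x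
  define v where "v m x = sin (inverse (real (Suc m)) * V x) / inverse (real (Suc m))" for m x
  have [measurable]: "random_variable borel (u m)" "random_variable borel (v m)" for m
    unfolding u_def[abs_def] v_def[abs_def] by measurable
  have "\<bar>u m x\<bar> ^ n \<le> \<bar>U x\<bar> ^ n" "\<bar>v m x\<bar> ^ n \<le> \<bar>V x\<bar> ^ n" for m x
    unfolding u_def v_def by (intro power_mono abs_sin_scaled_le abs_ge_zero; simp)+
  then have le: "u m x ^ n \<le> U x ^ n" "v m x ^ n \<le> V x ^ n" for m x
    using \<open>even n\<close> by (simp_all only: power_even_abs)
  have nonneg: "0 \<le> u m x ^ n" "0 \<le> v m x ^ n" "0 \<le> U x ^ n" "0 \<le> V x ^ n" for m x
    using \<open>even n\<close> by (simp_all add: zero_le_even_power)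
  have int_u: "integrable M (\<lambda>x. u m x ^ n)" for m
    by (rule Bochner_Integration.integrable_bound[OF int(1)]) (auto simp: le nonneg)
  have int_v: "integrable M (\<lambda>x. v m x ^ n)" for m
    by (rule Bochner_Integration.integrable_bound[OF int(2)]) (auto simp: le nonneg)
  have int_uv: "integrable M (\<lambda>x. u m x ^ n * v m x ^ n)" for m
  proof (rule integrable_const_bound[where B="(real (Suc m)) ^ n * (real (Suc m)) ^ n"])
    have "\<bar>u m x\<bar> \<le> real (Suc m)" "\<bar>v m x\<bar> \<le> real (Suc m)" for x
      by (simp_all add: u_def v_def abs_mult divide_inverse mult_le_cancel_right1)
    then show "AE x in M. norm (u m x ^ n * v m x ^ n) \<le> real (Suc m) ^ n * real (Suc m) ^ n"
      by (auto simp: abs_mult power_abs intro!: mult_mono power_mono)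
  qed measurable
  define C where "C = expectation (\<lambda>x. U x ^ n) * expectation (\<lambda>x. V x ^ n)"
  have "\<forall>\<^sub>F m in sequentially. (\<integral>\<^sup>+x. ennreal (u m x ^ n * v m x ^ n) \<partial>M) \<le> ennreal C"
    using expectation_sin_power_mult[OF loc, of n n]
  proof eventually_elim
    case (elim m)
    have "expectation (\<lambda>x. u m x ^ n) \<le> expectation (\<lambda>x. U x ^ n)" "expectation (\<lambda>x. v m x ^ n) \<le> expectation (\<lambda>x. V x ^ n)"
      by (auto intro!: Bochner_Integration.integral_mono int int_u int_v le)
    then have "expectation (\<lambda>x. u m x ^ n * v m x ^ n) \<le> C"
      using elim[folded u_def v_def] unfolding C_def by (auto intro!: mult_mono integral_nonneg_AE nonneg)
    then show ?case
      using int_uv nonneg by (subst nn_integral_eq_integral) (auto intro: ennreal_leI)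
  qed
  then have "liminf (\<lambda>m. \<integral>\<^sup>+x. ennreal (u m x ^ n * v m x ^ n) \<partial>M) \<le> ennreal C"
    by (intro order_trans[OF Liminf_le_Limsup Limsup_bounded]) simp_all
  moreover have "liminf (\<lambda>m. ennreal (u m x ^ n * v m x ^ n)) = ennreal (U x ^ n * V x ^ n)" for x
    unfolding u_def v_def
    by (intro lim_imp_Liminf tendsto_ennrealI tendsto_mult tendsto_power sin_scaled_tendsto) simp
  ultimately have "(\<integral>\<^sup>+x. ennreal (U x ^ n * V x ^ n) \<partial>M) \<le> ennreal C"
    using nn_integral_liminf[of "\<lambda>m x. ennreal (u m x ^ n * v m x ^ n)" M] by simp
  then have "(\<integral>\<^sup>+x. ennreal (norm (U x ^ n * V x ^ n)) \<partial>M) < \<infinity>"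
    using nonneg by (simp add: le_less_trans[OF _ ennreal_less_top])
  then show ?thesis
    by (simp add: integrable_iff_bounded)
qed

text \<open>With all moments finite, the mixed power of \<open>U\<close> and \<open>V\<close> is an
  integrable bound for that of the truncations, so dominated convergence gives equality in the
  limit.\<close>

lemma locally_independent_expectation_power:
  assumes loc: "locally_independent U V" and U: "all_moments U" and V: "all_moments V"
  shows "expectation (\<lambda>x. U x ^ p * V x ^ q) = expectation (\<lambda>x. U x ^ p) * expectation (\<lambda>x. V x ^ q)"
proof -
  have [measurable]: "random_variable borel U" "random_variable borel V"
    using loc by (auto simp: locally_independent_def)
  define u where "u m x = sin (inverse (real (Suc m)) * U x) / inverse (real (Suc m))" for m x
  define v where "v m x = sin (inverse (real (Suc m)) * V x) / inverse (real (Suc m))" for m x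
  have [measurable]: "random_variable borel (u m)" "random_variable borel (v m)" for m
    unfolding u_def[abs_def] v_def[abs_def] by measurable
  have le: "\<bar>u m x\<bar> \<le> \<bar>U x\<bar>" "\<bar>v m x\<bar> \<le> \<bar>V x\<bar>" for m x
    unfolding u_def v_def by (rule abs_sin_scaled_le; simp)+
  have lim: "(\<lambda>m. u m x) \<longlonglongrightarrow> U x" "(\<lambda>m. v m x) \<longlonglongrightarrow> V x" for x
    unfolding u_def v_def by (rule sin_scaled_tendsto)+
  have conv: "(\<lambda>m. expectation (\<lambda>x. u m x ^ p * v m x ^ q)) \<longlonglongrightarrow> expectation (\<lambda>x. U x ^ p * V x ^ q)" for p q
  proof (rule integral_dominated_convergence[where w="\<lambda>x. norm (U x ^ p * V x ^ q)"])
    show "integrable M (\<lambda>x. norm (U x ^ p * V x ^ q))"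
      by (intro integrable_norm all_moments_integrable_mult U V)
    show "AE x in M. (\<lambda>m. u m x ^ p * v m x ^ q) \<longlonglongrightarrow> U x ^ p * V x ^ q"
      by (intro AE_I2 tendsto_intros lim)
    show "AE x in M. norm (u m x ^ p * v m x ^ q) \<le> norm (U x ^ p * V x ^ q)" for m
      by (intro AE_I2) (auto simp: abs_mult power_abs intro!: mult_mono power_mono le)
  qed measurable
  \<comment> \<open>The exponent pairs (p, 0) and (0, q) in \<open>conv\<close> give the limits of
    the two factors.\<close>
  have "(\<lambda>m. expectation (\<lambda>x. u m x ^ p * v m x ^ q)) \<longlonglongrightarrow> expectation (\<lambda>x. U x ^ p) * expectation (\<lambda>x. V x ^ q)"
    using tendsto_mult[OF conv[of p 0] conv[of 0 q]] expectation_sin_power_mult[OF loc, of p q, folded u_def v_def]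
    by (simp add: tendsto_cong)
  with conv show ?thesis by (rule LIMSEQ_unique)
qed

end

section \<open>Shared noises\<close>

context prob_space
begin

text \<open>By independence of the noises, the joint and marginal characteristic functions are
  products over \<open>I\<close>. Outside \<open>K\<close> one of the two coefficients is 0, so
  those factors split of their own accord; near 0 they are nonzero and cancel.\<close>

lemma locally_independent_shared:
  fixes \<epsilon> :: "'i \<Rightarrow> 'a \<Rightarrow> real"
  assumes "finite I" and ind: "indep_vars (\<lambda>_. borel) \<epsilon> I"
    and indep: "indep_var borel (\<lambda>x. \<Sum>k\<in>I. a k * \<epsilon> k x) borel (\<lambda>x. \<Sum>k\<in>I. b k * \<epsilon> k x)"
  defines "K \<equiv> {k \<in> I. a k \<noteq> 0 \<and> b k \<noteq> 0}"
  shows "locally_independent (\<lambda>x. \<Sum>k\<in>K. a k * \<epsilon> k x) (\<lambda>x. \<Sum>k\<in>K. b k * \<epsilon> k x)"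
proof -
  have meas: "random_variable borel (\<epsilon> k)" if "k \<in> I" for k
    using ind that by (auto simp: indep_vars_def)
  have K: "finite K" "K \<subseteq> I" using \<open>finite I\<close> by (auto simp: K_def)
  define \<phi> where "\<phi> k t = (CLINT x|M. iexp (t * \<epsilon> k x))" for k t
  have prod: "(CLINT x|M. iexp (\<Sum>k\<in>J. c k * \<epsilon> k x)) = (\<Prod>k\<in>J. \<phi> k (c k))" if "J \<subseteq> I" for J c
  proof -
    have J: "finite J" using that \<open>finite I\<close> finite_subset by blast
    have "(CLINT x|M. iexp (\<Sum>k\<in>J. c k * \<epsilon> k x)) = (CLINT x|M. (\<Prod>k\<in>J. iexp (c k * \<epsilon> k x)))"
      using J by (simp add: exp_sum sum_distrib_left)
    also have "\<dots> = (\<Prod>k\<in>J. \<phi> k (c k))"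
      unfolding \<phi>_def
    proof (rule indep_vars_lebesgue_integral[OF J])
      show "indep_vars (\<lambda>_. borel) (\<lambda>k x. iexp (c k * \<epsilon> k x)) J"
        by (rule indep_vars_compose2[OF indep_vars_subset[OF ind that], where Y="\<lambda>k x. iexp (c k * x)"]) auto
      show "integrable M (\<lambda>x. iexp (c k * \<epsilon> k x))" if "k \<in> J" for k
        using that \<open>J \<subseteq> I\<close> by (intro integrable_iexp_real meas) auto
    qed
    finally show ?thesis .
  qed
  have joint: "(CLINT x|M. iexp (t * (\<Sum>k\<in>J. a k * \<epsilon> k x)) * iexp (s * (\<Sum>k\<in>J. b k * \<epsilon> k x))) =
      (\<Prod>k\<in>J. \<phi> k (t * a k + s * b k))" if "J \<subseteq> I" for J t s
  proof -
    have "iexp (t * (\<Sum>k\<in>J. a k * \<epsilon> k x)) * iexp (s * (\<Sum>k\<in>J. b k * \<epsilon> k x)) =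
        iexp (\<Sum>k\<in>J. (t * a k + s * b k) * \<epsilon> k x)" for x
    proof -
      have "(\<Sum>k\<in>J. (t * a k + s * b k) * \<epsilon> k x) = t * (\<Sum>k\<in>J. a k * \<epsilon> k x) + s * (\<Sum>k\<in>J. b k * \<epsilon> k x)"
        by (simp add: sum_distrib_left sum.distrib[symmetric] algebra_simps)
      then show ?thesis by (simp only: of_real_add distrib_left exp_add)
    qed
    then show ?thesis using prod[OF that, of "\<lambda>k. t * a k + s * b k"] by simp
  qed
  have margA: "(CLINT x|M. iexp (t * (\<Sum>k\<in>J. a k * \<epsilon> k x))) = (\<Prod>k\<in>J. \<phi> k (t * a k))"
    and margB: "(CLINT x|M. iexp (t * (\<Sum>k\<in>J. b k * \<epsilon> k x))) = (\<Prod>k\<in>J. \<phi> k (t * b k))"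
    if "J \<subseteq> I" for J t
    using joint[OF that, of t 0] joint[OF that, of 0 t] by simp_all
  have \<phi>0: "\<phi> k 0 = 1" for k by (simp add: \<phi>_def prob_space)
  \<comment> \<open>Each noise has a continuous characteristic function with value 1 at 0, and
    finiteness of \<open>I\<close> gives a common neighbourhood.\<close>
  have ev: "\<forall>\<^sub>F t in nhds 0. \<forall>k\<in>I. \<phi> k (t * c k) \<noteq> 0" for c :: "'i \<Rightarrow> real"
  proof (rule eventually_ball_finite[OF \<open>finite I\<close>, rule_format])
    fix k assume k: "k \<in> I"
    interpret D: real_distribution "distr M borel (\<epsilon> k)"
      by (rule real_distribution_distr) (rule meas[OF k])
    have "\<phi> k = char (distr M borel (\<epsilon> k))"
      using meas[OF k] by (auto simp: \<phi>_def char_def integral_distr)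
    then have "isCont (\<phi> k) (0 * c k)" using D.isCont_char by simp
    moreover have "isCont (\<lambda>t. t * c k) 0" by (intro continuous_intros)
    ultimately have "isCont (\<lambda>t. \<phi> k (t * c k)) 0"
      using isCont_o2[of 0 "\<lambda>t. t * c k" "\<phi> k"] by simp
    then have "((\<lambda>t. \<phi> k (t * c k)) \<longlongrightarrow> 1) (nhds 0)"
      using tendsto_at_iff_tendsto_nhds[of "\<lambda>t. \<phi> k (t * c k)" 0] by (simp add: isCont_def \<phi>0)
    then show "\<forall>\<^sub>F t in nhds 0. \<phi> k (t * c k) \<noteq> 0"
      by (rule tendsto_imp_eventually_ne) simp
  qed
  have "\<forall>\<^sub>F t in nhds 0. (\<forall>k\<in>I. \<phi> k (t * a k) \<noteq> 0) \<and> (\<forall>k\<in>I. \<phi> k (t * b k) \<noteq> 0)"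
    using ev[of a] ev[of b] by (rule eventually_conj)
  then obtain \<delta> where \<delta>: "\<delta> > 0" "\<And>t k. \<bar>t\<bar> < \<delta> \<Longrightarrow> k \<in> I \<Longrightarrow> \<phi> k (t * a k) \<noteq> 0 \<and> \<phi> k (t * b k) \<noteq> 0"
    unfolding eventually_nhds_metric by (auto simp: dist_real_def)
  have "(\<Prod>k\<in>K. \<phi> k (t * a k + s * b k)) = (\<Prod>k\<in>K. \<phi> k (t * a k)) * (\<Prod>k\<in>K. \<phi> k (s * b k))"
    if ts: "\<bar>t\<bar> < \<delta>" "\<bar>s\<bar> < \<delta>" for t s
  proof -
    have 1: "indep_var borel (\<lambda>x. iexp (t * (\<Sum>k\<in>I. a k * \<epsilon> k x))) borel (\<lambda>x. iexp (s * (\<Sum>k\<in>I. b k * \<epsilon> k x)))"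
      using indep_var_compose[OF indep, of "\<lambda>x. iexp (t * x)" borel "\<lambda>x. iexp (s * x)" borel] by (simp add: o_def)
    have 2: "integrable M (\<lambda>x. iexp (r * (\<Sum>k\<in>I. c k * \<epsilon> k x)))" for r c
      by (intro integrable_iexp_real borel_measurable_sum borel_measurable_times borel_measurable_const meas)
    have "(\<Prod>k\<in>I. \<phi> k (t * a k + s * b k)) = (\<Prod>k\<in>I. \<phi> k (t * a k)) * (\<Prod>k\<in>I. \<phi> k (s * b k))"
      using indep_var_lebesgue_integral[OF 1 2 2]
      unfolding joint[OF order_refl] margA[OF order_refl] margB[OF order_refl] .
    also have "\<dots> = (\<Prod>k\<in>K. \<phi> k (t * a k)) * (\<Prod>k\<in>K. \<phi> k (s * b k)) * (\<Prod>k\<in>I-K. \<phi> k (t * a k) * \<phi> k (s * b k))"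
      by (simp add: prod.subset_diff[OF K(2) \<open>finite I\<close>] prod.distrib)
    also have "(\<Prod>k\<in>I-K. \<phi> k (t * a k) * \<phi> k (s * b k)) = (\<Prod>k\<in>I-K. \<phi> k (t * a k + s * b k))"
      by (intro prod.cong refl) (auto simp: K_def \<phi>0)
    finally have "(\<Prod>k\<in>K. \<phi> k (t * a k + s * b k)) * (\<Prod>k\<in>I-K. \<phi> k (t * a k + s * b k)) =
      (\<Prod>k\<in>K. \<phi> k (t * a k)) * (\<Prod>k\<in>K. \<phi> k (s * b k)) * (\<Prod>k\<in>I-K. \<phi> k (t * a k + s * b k))"
      by (simp add: prod.subset_diff[OF K(2) \<open>finite I\<close>])
    moreover have "\<phi> k (t * a k + s * b k) \<noteq> 0" if "k \<in> I - K" for k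
      using \<delta>(2)[OF ts(1), of k] \<delta>(2)[OF ts(2), of k] that by (auto simp: K_def \<phi>0)
    then have "(\<Prod>k\<in>I-K. \<phi> k (t * a k + s * b k)) \<noteq> 0"
      using \<open>finite I\<close> by simp
    ultimately show ?thesis by simp
  qed
  moreover have "random_variable borel (\<lambda>x. \<Sum>k\<in>K. c k * \<epsilon> k x)" for c
    using K by (intro borel_measurable_sum borel_measurable_times borel_measurable_const meas) auto
  ultimately show ?thesis
    unfolding locally_independent_def joint[OF K(2)] margA[OF K(2)] margB[OF K(2)]
    using \<delta>(1) by blast
qed

section \<open>Moment doubling for the shared noises\<close>

lemma integrable_power_even_add:
  fixes X Y :: "'a \<Rightarrow> real"
  assumes "even n" and [measurable]: "random_variable borel X" "random_variable borel Y"
    and X: "integrable M (\<lambda>x. X x ^ n)" and Y: "integrable M (\<lambda>x. Y x ^ n)"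
  shows "integrable M (\<lambda>x. (X x + Y x) ^ n)"
proof (rule Bochner_Integration.integrable_bound)
  show "integrable M (\<lambda>x. 2 ^ n * (X x ^ n + Y x ^ n))"
    by (intro integrable_mult_right Bochner_Integration.integrable_add X Y)
  have "(u + v) ^ n \<le> 2 ^ n * (u ^ n + v ^ n)" for u v :: real
  proof -
    have "\<bar>u + v\<bar> ^ n \<le> (2 * max \<bar>u\<bar> \<bar>v\<bar>) ^ n" by (intro power_mono) auto
    also have "\<dots> = 2 ^ n * max \<bar>u\<bar> \<bar>v\<bar> ^ n" by (rule power_mult_distrib)
    also have "\<dots> \<le> 2 ^ n * (\<bar>u\<bar> ^ n + \<bar>v\<bar> ^ n)" by (intro mult_left_mono) (auto simp: max_def)
    finally show ?thesis using \<open>even n\<close> by (simp only: power_even_abs)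
  qed
  then show "AE x in M. norm ((X x + Y x) ^ n) \<le> norm (2 ^ n * (X x ^ n + Y x ^ n))"
    using \<open>even n\<close> by (intro AE_I2) (simp add: zero_le_even_power)
qed measurable

lemma integrable_power_even_linear_combination:
  fixes \<epsilon> :: "'i \<Rightarrow> 'a \<Rightarrow> real"
  assumes "even n" "finite K" "\<And>k. k \<in> K \<Longrightarrow> random_variable borel (\<epsilon> k)"
    "\<And>k. k \<in> K \<Longrightarrow> integrable M (\<lambda>x. \<epsilon> k x ^ n)"
  shows "integrable M (\<lambda>x. (\<Sum>k\<in>K. c k * \<epsilon> k x) ^ n)"
  using assms(2-)
proof (induction K)
  case (insert k K)
  have "integrable M (\<lambda>x. (c k * \<epsilon> k x + (\<Sum>k\<in>K. c k * \<epsilon> k x)) ^ n)"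
    using insert \<open>even n\<close>
    by (intro integrable_power_even_add borel_measurable_sum borel_measurable_times borel_measurable_const) (auto simp: power_mult_distrib)
  then show ?case using insert by simp
qed simp

text \<open>Otherwise \<open>W\<close> would exceed every natural number almost surely. It supplies
  the event on which the remaining noises are bounded.\<close>

lemma exists_bounded_with_positive_prob:
  fixes W :: "'a \<Rightarrow> real"
  shows "\<exists>c::nat. \<not> (AE x in M. indicator {..real c} (W x) = (0::real))"
proof (rule ccontr)
  assume "\<not> ?thesis"
  then have "AE x in M. \<forall>c::nat. indicator {..real c} (W x) = (0::real)"
    by (simp add: AE_all_countable)
  moreover have "\<not> (\<forall>c::nat. indicator {..real c} (W x) = (0::real))" for x
    using real_arch_simple[of "W x"] by (auto simp: indicator_def)
  ultimately show False by simp
qed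

text \<open>If |e| \<le> 2d/\<alpha>, the first summand suffices. Otherwise both remainders are
  smaller than \<alpha>|e|/2, so each linear expression has absolute value at least
  \<alpha>|e|/2.\<close>

lemma power_le_product_of_far:
  fixes e R R' :: real
  assumes "\<alpha> > 0" "\<alpha> \<le> \<bar>a\<bar>" "\<alpha> \<le> \<bar>b\<bar>" "\<bar>R\<bar> \<le> d" "\<bar>R'\<bar> \<le> d" "even n"
  shows "e ^ (2 * n) \<le> (2 * d / \<alpha>) ^ (2 * n) + (2 / \<alpha>) ^ (2 * n) * ((a * e + R) ^ n * (b * e + R') ^ n)"
proof -
  have nn: "0 \<le> (a * e + R) ^ n * (b * e + R') ^ n" "0 \<le> (2 * d / \<alpha>) ^ (2 * n)" "0 \<le> (2 / \<alpha>) ^ (2 * n)"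
    using \<open>even n\<close> by (simp_all add: zero_le_even_power)
  show ?thesis
  proof (cases "\<bar>e\<bar> \<le> 2 * d / \<alpha>")
    case True
    then have "\<bar>e\<bar> ^ (2 * n) \<le> (2 * d / \<alpha>) ^ (2 * n)" by (intro power_mono) auto
    then show ?thesis using nn by (simp add: power_even_abs add_increasing2)
  next
    case False
    then have d: "2 * d < \<alpha> * \<bar>e\<bar>" using assms(1) by (simp add: field_simps)
    have far: "\<bar>e\<bar> \<le> 2 / \<alpha> * \<bar>f * e + r\<bar>" if "\<alpha> \<le> \<bar>f\<bar>" "\<bar>r\<bar> \<le> d" for f r
    proof -
      have "\<alpha> * \<bar>e\<bar> \<le> \<bar>f * e\<bar>" unfolding abs_mult using that by (intro mult_right_mono) auto
      then have "\<alpha> * \<bar>e\<bar> \<le> 2 * \<bar>f * e + r\<bar>"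
        using d that abs_triangle_ineq4[of "f * e + r" r] by simp
      then show ?thesis using assms(1) by (simp add: field_simps)
    qed
    have "\<bar>e\<bar> ^ n * \<bar>e\<bar> ^ n \<le> (2 / \<alpha> * \<bar>a * e + R\<bar>) ^ n * (2 / \<alpha> * \<bar>b * e + R'\<bar>) ^ n"
      using assms by (intro mult_mono power_mono far) auto
    also have "\<dots> = (2 / \<alpha>) ^ (2 * n) * ((a * e + R) ^ n * (b * e + R') ^ n)"
      unfolding mult_2 power_add using \<open>even n\<close> by (simp only: power_mult_distrib power_even_abs mult_ac)
    finally have "e ^ (2 * n) \<le> (2 / \<alpha>) ^ (2 * n) * ((a * e + R) ^ n * (b * e + R') ^ n)"
      using \<open>even n\<close> by (simp only: mult_2 power_add power_even_abs)
    then show ?thesis using nn(2) by linarith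
  qed
qed

text \<open>The product of the n-th powers of the two combinations is integrable by the Fatou
  argument. Where the other noises are bounded, both combinations are large when
  \<open>\<epsilon> k\<close> is, so the power 2n of \<open>\<epsilon> k\<close> is integrable
  there; independence from the other noises then lifts the restriction.\<close>

lemma shared_noise_moment_doubling:
  fixes \<epsilon> :: "'i \<Rightarrow> 'a \<Rightarrow> real"
  assumes "finite K" and ind: "indep_vars (\<lambda>_. borel) \<epsilon> K"
    and loc: "locally_independent (\<lambda>x. \<Sum>k\<in>K. a k * \<epsilon> k x) (\<lambda>x. \<Sum>k\<in>K. b k * \<epsilon> k x)"
    and "even n" and int: "\<And>k. k \<in> K \<Longrightarrow> integrable M (\<lambda>x. \<epsilon> k x ^ n)"
    and k: "k \<in> K" "a k \<noteq> 0" "b k \<noteq> 0"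
  shows "integrable M (\<lambda>x. \<epsilon> k x ^ (2 * n))"
proof -
  have meas: "random_variable borel (\<epsilon> j)" if "j \<in> K" for j
    using ind that by (auto simp: indep_vars_def)
  note [measurable] = meas[OF k(1)]
  define U where "U x = (\<Sum>k\<in>K. a k * \<epsilon> k x)" for x
  define V where "V x = (\<Sum>k\<in>K. b k * \<epsilon> k x)" for x
  have UV: "integrable M (\<lambda>x. U x ^ n * V x ^ n)"
    unfolding U_def V_def
    by (intro locally_independent_integrable_mult loc integrable_power_even_linear_combination assms meas)
  define J where "J = K - {k}"
  have J: "finite J" "k \<notin> J" "insert k J = K" using \<open>finite K\<close> k by (auto simp: J_def)
  \<comment> \<open>A single variable, independent of \<open>\<epsilon> k\<close>, that bounds all
    other noises at once.\<close>
  define W where "W x = (\<Sum>j\<in>J. \<bar>\<epsilon> j x\<bar>)" for x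
  have W_meas [measurable]: "random_variable borel W"
    unfolding W_def[abs_def] by (intro borel_measurable_sum borel_measurable_abs meas) (auto simp: J_def)
  have indep: "indep_var borel (\<lambda>x. \<bar>\<epsilon> k x\<bar>) borel W"
    unfolding W_def[abs_def]
    by (rule indep_vars_sum[OF J(1,2), where X="\<lambda>k x. \<bar>\<epsilon> k x\<bar>"])
      (use indep_vars_compose2[OF ind, of "\<lambda>_ x. \<bar>x\<bar>"] J in auto)
  obtain c :: nat where c: "\<not> (AE x in M. indicator {..real c} (W x) = (0::real))"
    using exists_bounded_with_positive_prob[of W] by blast
  \<comment> \<open>A common bound for the coefficients of both combinations, so that
    \<open>rest\<close> applies to either.\<close>
  define D where "D = (\<Sum>j\<in>J. \<bar>a j\<bar> + \<bar>b j\<bar>)"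
  have rest: "\<bar>\<Sum>j\<in>J. f j * \<epsilon> j x\<bar> \<le> D * real c" if "W x \<le> real c" "\<And>j. \<bar>f j\<bar> \<le> \<bar>a j\<bar> + \<bar>b j\<bar>" for f x
  proof -
    have "\<bar>\<Sum>j\<in>J. f j * \<epsilon> j x\<bar> \<le> (\<Sum>j\<in>J. D * \<bar>\<epsilon> j x\<bar>)"
    proof (rule order_trans[OF sum_abs], rule sum_mono)
      fix j assume "j \<in> J"
      then have "\<bar>a j\<bar> + \<bar>b j\<bar> \<le> D" unfolding D_def using J(1)
        by (intro member_le_sum[of j J "\<lambda>j. \<bar>a j\<bar> + \<bar>b j\<bar>"]) auto
      with that(2)[of j] have "\<bar>f j\<bar> \<le> D" by linarith
      then show "\<bar>f j * \<epsilon> j x\<bar> \<le> D * \<bar>\<epsilon> j x\<bar>" by (simp add: abs_mult mult_right_mono)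
    qed
    also have "\<dots> = D * W x" by (simp add: W_def sum_distrib_left)
    also have "\<dots> \<le> D * real c" using that(1) by (intro mult_left_mono) (auto simp: D_def intro!: sum_nonneg)
    finally show ?thesis .
  qed
  define \<alpha> where "\<alpha> = min \<bar>a k\<bar> \<bar>b k\<bar>"
  have "\<alpha> > 0" using k by (auto simp: \<alpha>_def)
  have split: "U x = a k * \<epsilon> k x + (\<Sum>j\<in>J. a j * \<epsilon> j x)" "V x = b k * \<epsilon> k x + (\<Sum>j\<in>J. b j * \<epsilon> j x)" for x
    using J by (simp_all add: U_def V_def flip: J(3))
  define d where "d = D * real c"
  have bound: "\<bar>\<epsilon> k x\<bar> ^ (2 * n) * indicator {..real c} (W x) \<le>
      (2 * d / \<alpha>) ^ (2 * n) + (2 / \<alpha>) ^ (2 * n) * (U x ^ n * V x ^ n)" for x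
  proof (cases "W x \<le> real c")
    case True
    have "\<epsilon> k x ^ (2 * n) \<le> (2 * d / \<alpha>) ^ (2 * n) + (2 / \<alpha>) ^ (2 * n) * (U x ^ n * V x ^ n)"
      unfolding split d_def
      by (rule power_le_product_of_far[OF \<open>\<alpha> > 0\<close>]) (auto simp: \<alpha>_def intro!: rest[OF True] \<open>even n\<close>)
    then show ?thesis using True by (simp add: power_even_abs)
  next
    case False
    then show ?thesis using \<open>even n\<close> by (auto intro!: add_nonneg_nonneg mult_nonneg_nonneg simp: zero_le_even_power)
  qed
  have "integrable M (\<lambda>x. \<bar>\<epsilon> k x\<bar> ^ (2 * n) * indicator {..real c} (W x))"
  proof (rule Bochner_Integration.integrable_bound)
    show "integrable M (\<lambda>x. (2 * d / \<alpha>) ^ (2 * n) + (2 / \<alpha>) ^ (2 * n) * (U x ^ n * V x ^ n))"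
      by (intro Bochner_Integration.integrable_add integrable_mult_right UV) simp
    show "AE x in M. norm (\<bar>\<epsilon> k x\<bar> ^ (2 * n) * indicator {..real c} (W x)) \<le>
        norm ((2 * d / \<alpha>) ^ (2 * n) + (2 / \<alpha>) ^ (2 * n) * (U x ^ n * V x ^ n))"
      using bound by (intro AE_I2) (auto intro: order_trans[OF _ abs_ge_self])
  qed measurable
  \<comment> \<open>The indicator depends on \<open>W\<close> alone and is not almost surely zero,
    so it can be divided out.\<close>
  from integrable_factor_of_indep[OF indep, of "\<lambda>x. x ^ (2 * n)" "indicator {..real c}", OF _ _ _ _ this c]
  have "integrable M (\<lambda>x. \<bar>\<epsilon> k x\<bar> ^ (2 * n))" by simp
  then show ?thesis by (simp add: power_even_abs)
qed

text \<open>Doubling from the second moment reaches every exponent 2^(m+1), and these control all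
  others. The induction treats all noises in \<open>K\<close> together, because one doubling uses
  the n-th moments of every one of them.\<close>

lemma shared_noise_all_moments:
  fixes \<epsilon> :: "'i \<Rightarrow> 'a \<Rightarrow> real"
  assumes "finite K" and ind: "indep_vars (\<lambda>_. borel) \<epsilon> K"
    and loc: "locally_independent (\<lambda>x. \<Sum>k\<in>K. a k * \<epsilon> k x) (\<lambda>x. \<Sum>k\<in>K. b k * \<epsilon> k x)"
    and int: "\<And>k. k \<in> K \<Longrightarrow> integrable M (\<lambda>x. (\<epsilon> k x)\<^sup>2)"
    and nz: "\<And>k. k \<in> K \<Longrightarrow> a k \<noteq> 0 \<and> b k \<noteq> 0" and "k \<in> K"
  shows "all_moments (\<epsilon> k)"
proof -
  have meas: "random_variable borel (\<epsilon> k)"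
    using ind \<open>k \<in> K\<close> by (auto simp: indep_vars_def)
  have two: "integrable M (\<lambda>x. \<epsilon> k x ^ (2 ^ Suc m))" if "k \<in> K" for m k
    using that
  proof (induction m arbitrary: k)
    case (Suc m)
    have "integrable M (\<lambda>x. \<epsilon> k x ^ (2 * 2 ^ Suc m))"
      by (rule shared_noise_moment_doubling[OF assms(1-3)]) (use nz Suc in auto)
    then show ?case by (simp only: power_Suc)
  qed (simp add: int)
  have "integrable M (\<lambda>x. \<epsilon> k x ^ n)" for n
  proof (rule Bochner_Integration.integrable_bound)
    show "integrable M (\<lambda>x. 1 + \<epsilon> k x ^ (2 ^ Suc n))"
      by (intro Bochner_Integration.integrable_add two \<open>k \<in> K\<close>) simp
    have "n \<le> 2 ^ Suc n" using less_exp[of "Suc n"] by linarith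
    then have "\<bar>u\<bar> ^ n \<le> 1 + \<bar>u\<bar> ^ (2 ^ Suc n)" for u :: real
      using power_increasing[of n "2 ^ Suc n" "\<bar>u\<bar>"] power_le_one[of "\<bar>u\<bar>" n]
      by (cases "\<bar>u\<bar> \<ge> 1") (auto simp: add_increasing2)
    moreover have "\<bar>u\<bar> ^ (2 ^ Suc n) = u ^ (2 ^ Suc n)" for u :: real
      by (rule power_even_abs) simp
    ultimately have "\<bar>\<epsilon> k x ^ n\<bar> \<le> 1 + \<epsilon> k x ^ (2 ^ Suc n)" for x
      by (metis power_abs)
    then show "AE x in M. norm (\<epsilon> k x ^ n) \<le> norm (1 + \<epsilon> k x ^ (2 ^ Suc n))"
      unfolding real_norm_def by (intro AE_I2 order_trans[OF _ abs_ge_self])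
  qed (use meas in measurable)
  with meas show ?thesis by (simp add: all_moments_def)
qed

end

section \<open>The Darmois--Skitovich theorem\<close>

text \<open>Infinitely many real roots force the polynomial to vanish; used to compare coefficients
  in a real parameter s.\<close>

lemma poly_zero_on_reals:
  fixes C :: "nat \<Rightarrow> complex"
  assumes "\<And>s::real. (\<Sum>i\<le>n. C i * of_real s ^ i) = 0" and "i \<le> n"
  shows "C i = 0"
proof -
  define p where "p = (\<Sum>i\<le>n. monom (C i) i)"
  have "poly p (of_real s) = 0" for s
    using assms(1)[of s] by (simp add: p_def poly_sum poly_monom)
  then have "range complex_of_real \<subseteq> {z. poly p z = 0}" by auto
  moreover have "infinite (range complex_of_real)"
    by (simp add: finite_image_iff inj_of_real infinite_UNIV_char_0)
  ultimately have "p = 0" using poly_roots_finite finite_subset by blast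
  then have "coeff p i = 0" by simp
  then show ?thesis using \<open>i \<le> n\<close> by (simp add: p_def coeff_sum)
qed

text \<open>A Vandermonde argument: test the moment relations against the polynomial vanishing at
  all ratios other than \<open>\<rho>\<close>.\<close>

lemma vandermonde_class_sum:
  fixes w r :: "'k \<Rightarrow> 'a::field"
  assumes "finite K" and rel: "\<And>q. 1 \<le> q \<Longrightarrow> q \<le> card K \<Longrightarrow> (\<Sum>k\<in>K. w k * r k ^ q) = 0"
    and "\<rho> \<noteq> 0"
  shows "(\<Sum>k | k \<in> K \<and> r k = \<rho>. w k) = 0"
proof (cases "\<exists>k\<in>K. r k = \<rho>")
  case False
  then have "{k. k \<in> K \<and> r k = \<rho>} = {}" by auto
  then show ?thesis by (simp only: sum.empty)
next
  case True
  define R where "R = r ` K - {\<rho>}"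
  have R: "finite R" "card R < card K"
  proof -
    have "\<rho> \<in> r ` K" using True by auto
    then have "card R < card (r ` K)" unfolding R_def using \<open>finite K\<close> by (intro card_Diff1_less) auto
    then show "card R < card K" using card_image_le[OF \<open>finite K\<close>, of r] by linarith
  qed (use \<open>finite K\<close> in \<open>simp add: R_def\<close>)
  \<comment> \<open>The test polynomial is x g(x): the factor x avoids the exponent q = 0, for which
    no relation is given, and deg g < card K keeps all exponents at most card K.\<close>
  define g where "g = (\<Prod>x\<in>R. [:- x, 1:])"
  have deg: "degree g = card R" unfolding g_def by (subst degree_prod_eq_sum_degree) auto
  have "(\<Sum>k\<in>K. w k * (r k * poly g (r k))) = (\<Sum>k\<in>K. \<Sum>i\<le>card R. coeff g i * (w k * r k ^ Suc i))"
    by (simp add: poly_altdef deg sum_distrib_left mult_ac)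
  also have "\<dots> = (\<Sum>i\<le>card R. coeff g i * (\<Sum>k\<in>K. w k * r k ^ Suc i))"
    by (subst sum.swap) (simp add: sum_distrib_left)
  also have "\<dots> = 0" using R by (intro sum.neutral) (auto simp del: power_Suc intro!: rel)
  finally have "0 = (\<Sum>k\<in>K. w k * (r k * poly g (r k)))" ..
  also have "\<dots> = (\<Sum>k | k \<in> K \<and> r k = \<rho>. w k * (r k * poly g (r k)))"
  proof (rule sum.mono_neutral_right)
    show "\<forall>k\<in>K - {k. k \<in> K \<and> r k = \<rho>}. w k * (r k * poly g (r k)) = 0"
      using R(1) by (auto simp: g_def R_def poly_prod)
  qed (use \<open>finite K\<close> in auto)
  also have "\<dots> = (\<rho> * poly g \<rho>) * (\<Sum>k | k \<in> K \<and> r k = \<rho>. w k)"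
    by (simp add: sum_distrib_left mult_ac)
  finally have "(\<rho> * poly g \<rho>) * (\<Sum>k | k \<in> K \<and> r k = \<rho>. w k) = 0" by simp
  moreover have "poly g \<rho> \<noteq> 0" using R(1) by (auto simp: g_def poly_prod R_def)
  ultimately show ?thesis using \<open>\<rho> \<noteq> 0\<close> by simp
qed

section \<open>Cumulants of the noises with a common ratio\<close>

context prob_space
begin

text \<open>Mixed moments of U and sV factorise for every real s, so the cumulant of order n + 1 of
  U + sV is the sum of those of U and sV. Comparing coefficients in s, the sum of \<kappa>_k
  a_k^(n+1) (b_k/a_k)^q vanishes for 1 \<le> q \<le> n. For n \<ge> card K the Vandermonde argument
  isolates one ratio.\<close>

lemma shared_noise_class_cumulants:
  fixes \<epsilon> :: "'i \<Rightarrow> 'a \<Rightarrow> real"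
  assumes "finite K" and ind: "indep_vars (\<lambda>_. borel) \<epsilon> K"
    and loc: "locally_independent (\<lambda>x. \<Sum>k\<in>K. a k * \<epsilon> k x) (\<lambda>x. \<Sum>k\<in>K. b k * \<epsilon> k x)"
    and mom: "\<And>k. k \<in> K \<Longrightarrow> all_moments (\<epsilon> k)"
    and nz: "\<And>k. k \<in> K \<Longrightarrow> a k \<noteq> 0" and "\<rho> \<noteq> 0" and n: "n \<ge> card K"
  defines "S \<equiv> \<lambda>x. \<Sum>k | k \<in> K \<and> b k / a k = \<rho>. a k * \<epsilon> k x"
  shows "fps_nth (log_deriv (moment_fps S)) n = 0"
proof -
  define \<kappa> where "\<kappa> k = fps_nth (log_deriv (moment_fps (\<epsilon> k))) n" for k
  have ld: "fps_nth (log_deriv (moment_fps (\<lambda>x. \<Sum>k\<in>J. c k * \<epsilon> k x))) n = (\<Sum>k\<in>J. of_real (c k) ^ Suc n * \<kappa> k)"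
    if "J \<subseteq> K" for J c
  proof -
    have "moment_fps (\<lambda>x. \<Sum>k\<in>J. c k * \<epsilon> k x) = (\<Prod>k\<in>J. fps_scale (of_real (c k)) (moment_fps (\<epsilon> k)))"
      using that finite_subset[OF that \<open>finite K\<close>]
      by (intro moment_fps_linear_combination indep_vars_subset[OF ind] mom) auto
    then show ?thesis
      by (simp add: log_deriv_prod fps_sum_nth fps_nth_log_deriv_scale \<kappa>_def del: power_Suc)
  qed
  define U where "U x = (\<Sum>k\<in>K. a k * \<epsilon> k x)" for x
  define V where "V x = (\<Sum>k\<in>K. b k * \<epsilon> k x)" for x
  have UV: "all_moments U" "all_moments V"
    unfolding U_def[abs_def] V_def[abs_def] by (intro all_moments_sum all_moments_cmult mom; simp)+
  have eq: "(\<Sum>k\<in>K. (of_real (a k) + of_real s * of_real (b k)) ^ Suc n * \<kappa> k) =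
      (\<Sum>k\<in>K. of_real (a k) ^ Suc n * \<kappa> k) + (\<Sum>k\<in>K. (of_real s * of_real (b k)) ^ Suc n * \<kappa> k)" for s :: real
  proof -
    have "moment_fps (\<lambda>x. U x + s * V x) = moment_fps U * moment_fps (\<lambda>x. s * V x)"
    proof (rule moment_fps_add)
      show "expectation (\<lambda>x. U x ^ p * (s * V x) ^ q) = expectation (\<lambda>x. U x ^ p) * expectation (\<lambda>x. (s * V x) ^ q)" for p q
        using locally_independent_expectation_power[OF loc[folded U_def V_def] UV, of p q]
        by (simp add: power_mult_distrib mult.left_commute)
    qed (intro UV all_moments_cmult)+
    then have "log_deriv (moment_fps (\<lambda>x. U x + s * V x)) = log_deriv (moment_fps U) + log_deriv (moment_fps (\<lambda>x. s * V x))"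
      by (simp add: log_deriv_mult)
    moreover have "(\<lambda>x. U x + s * V x) = (\<lambda>x. \<Sum>k\<in>K. (a k + s * b k) * \<epsilon> k x)" "(\<lambda>x. s * V x) = (\<lambda>x. \<Sum>k\<in>K. (s * b k) * \<epsilon> k x)"
      by (simp_all add: U_def V_def sum_distrib_left sum.distrib[symmetric] algebra_simps)
    ultimately show ?thesis
      using ld[OF order_refl, of "\<lambda>k. a k + s * b k"] ld[OF order_refl, of a] ld[OF order_refl, of "\<lambda>k. s * b k"]
      unfolding U_def[abs_def] by (simp del: power_Suc)
  qed
  define w where "w k = of_real (a k) ^ Suc n * \<kappa> k" for k
  define r where "r k = complex_of_real (b k / a k)" for k
  \<comment> \<open>The coefficient of s^q in the difference of the two sides of \<open>eq\<close>;
    the corrections at q = 0 and q = \<open>Suc n\<close> come from the unmixed cumulants on the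
    right.\<close>
  define C where "C q = (of_nat (Suc n choose q) * (\<Sum>k\<in>K. w k * r k ^ q)) -
      (if q = 0 then (\<Sum>k\<in>K. w k) else 0) - (if q = Suc n then (\<Sum>k\<in>K. w k * r k ^ Suc n) else 0)" for q
  have ab: "of_real (a k) * r k = of_real (b k)" if "k \<in> K" for k
    using nz[OF that] by (simp add: r_def)
  have "(\<Sum>q\<le>Suc n. C q * of_real s ^ q) = 0" for s :: real
  proof -
    have "(\<Sum>k\<in>K. (of_real (a k) + of_real s * of_real (b k)) ^ Suc n * \<kappa> k) =
        (\<Sum>k\<in>K. w k * (of_real s * r k + 1) ^ Suc n)"
    proof (intro sum.cong refl)
      fix k assume "k \<in> K"
      have "of_real (a k) + of_real s * of_real (b k) = of_real (a k) * (of_real s * r k + 1)"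
        by (simp add: ab[OF \<open>k \<in> K\<close>, symmetric] algebra_simps)
      then show "(of_real (a k) + of_real s * of_real (b k)) ^ Suc n * \<kappa> k = w k * (of_real s * r k + 1) ^ Suc n"
        by (simp only: power_mult_distrib w_def mult_ac)
    qed
    also have "\<dots> = (\<Sum>k\<in>K. \<Sum>q\<le>Suc n. w k * (of_nat (Suc n choose q) * (of_real s * r k) ^ q))"
      by (simp only: binomial_ring power_one mult_1_right sum_distrib_left)
    also have "\<dots> = (\<Sum>q\<le>Suc n. of_nat (Suc n choose q) * (\<Sum>k\<in>K. w k * r k ^ q) * of_real s ^ q)"
      by (subst sum.swap) (intro sum.cong refl, simp only: sum_distrib_left sum_distrib_right power_mult_distrib mult_ac)
    finally have 1: "(\<Sum>k\<in>K. (of_real (a k) + of_real s * of_real (b k)) ^ Suc n * \<kappa> k) = \<dots>" .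
    have "(\<Sum>k\<in>K. (of_real s * of_real (b k)) ^ Suc n * \<kappa> k) = (\<Sum>k\<in>K. w k * r k ^ Suc n) * of_real s ^ Suc n"
      unfolding sum_distrib_right
      by (intro sum.cong refl) (simp only: ab[symmetric] power_mult_distrib w_def mult_ac)
    then show ?thesis
      using eq[of s] unfolding 1
      by (simp only: C_def left_diff_distrib sum_subtractf if_distrib[of "\<lambda>x. x * _"] mult_zero_left sum.delta finite_atMost)
        (simp add: w_def del: power_Suc binomial_Suc_Suc)
  qed
  then have C0: "C q = 0" if "q \<le> Suc n" for q using poly_zero_on_reals that by blast
  \<comment> \<open>Since n \<ge> card K, such q lie strictly between 0 and \<open>Suc n\<close>,
    where \<open>C\<close> has no correction and the binomial coefficient is nonzero.\<close>
  have rel: "(\<Sum>k\<in>K. w k * r k ^ q) = 0" if "1 \<le> q" "q \<le> card K" for q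
    using C0[of q] that n by (simp add: C_def del: binomial_Suc_Suc)
  have "(\<Sum>k | k \<in> K \<and> r k = of_real \<rho>. w k) = 0"
    by (rule vandermonde_class_sum[OF \<open>finite K\<close> rel]) (use \<open>\<rho> \<noteq> 0\<close> in auto)
  moreover have "{k. k \<in> K \<and> r k = of_real \<rho>} = {k. k \<in> K \<and> b k / a k = \<rho>}"
    by (auto simp: r_def simp del: of_real_divide)
  ultimately show ?thesis
    unfolding S_def using ld[of "{k. k \<in> K \<and> b k / a k = \<rho>}" a] by (simp add: w_def)
qed

text \<open>The shared noises with the same ratio b/a as \<open>\<epsilon> k\<close> have a weighted
  sum whose logarithmic derivative is a polynomial. Its independent summand
  \<open>a k * \<epsilon> k x\<close> then has a characteristic function of normal form, and
  non-Gaussianity leaves only variance 0.\<close>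

theorem darmois_skitovich:
  fixes \<epsilon> :: "'i \<Rightarrow> 'a \<Rightarrow> real"
  assumes "finite I" and ind: "indep_vars (\<lambda>_. borel) \<epsilon> I"
    and noise: "\<And>k. k \<in> I \<Longrightarrow> centered_var (\<epsilon> k)"
    and indep: "indep_var borel (\<lambda>x. \<Sum>k\<in>I. a k * \<epsilon> k x) borel (\<lambda>x. \<Sum>k\<in>I. b k * \<epsilon> k x)"
    and k: "k \<in> I" "a k \<noteq> 0" "b k \<noteq> 0" and nongaussian: "\<not> gaussian (\<epsilon> k)"
  shows "AE x in M. \<epsilon> k x = 0"
proof -
  define K where "K = {k \<in> I. a k \<noteq> 0 \<and> b k \<noteq> 0}"
  have K: "finite K" "K \<subseteq> I" "k \<in> K" using \<open>finite I\<close> k by (auto simp: K_def)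
  have indK: "indep_vars (\<lambda>_. borel) \<epsilon> K" using ind K(2) by (rule indep_vars_subset)
  have loc: "locally_independent (\<lambda>x. \<Sum>k\<in>K. a k * \<epsilon> k x) (\<lambda>x. \<Sum>k\<in>K. b k * \<epsilon> k x)"
    unfolding K_def by (rule locally_independent_shared[OF \<open>finite I\<close> ind indep])
  have mom: "all_moments (\<epsilon> j)" if "j \<in> K" for j
    by (rule shared_noise_all_moments[OF K(1) indK loc _ _ that]) (use noise K_def in \<open>auto simp: centered_var_def\<close>)
  have int: "integrable M (\<epsilon> j)" "expectation (\<epsilon> j) = 0" if "j \<in> K" for j
    using mom[OF that] noise[of j] that K(2) by (auto simp: all_moments_def centered_var_def dest: spec[of _ 1])
  define \<rho> where "\<rho> = b k / a k"
  \<comment> \<open>The other noises in the ratio class of \<open>\<epsilon> k\<close>; their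
    combination \<open>R\<close> is independent of \<open>X\<close>.\<close>
  define J where "J = {j. j \<in> K \<and> b j / a j = \<rho>} - {k}"
  have J: "finite J" "k \<notin> J" "J \<subseteq> K" "insert k J = {j. j \<in> K \<and> b j / a j = \<rho>}"
    using K by (auto simp: J_def \<rho>_def)
  define X where "X x = a k * \<epsilon> k x" for x
  define R where "R x = (\<Sum>j\<in>J. a j * \<epsilon> j x)" for x
  have S: "(\<lambda>x. X x + R x) = (\<lambda>x. \<Sum>j | j \<in> K \<and> b j / a j = \<rho>. a j * \<epsilon> j x)"
    using J(1,2) by (simp add: X_def R_def flip: J(4))
  have "fps_nth (log_deriv (moment_fps (\<lambda>x. X x + R x))) n = 0" if "n \<ge> card K" for n
    unfolding S by (rule shared_noise_class_cumulants[OF K(1) indK loc mom]) (use k that in \<open>auto simp: \<rho>_def K_def\<close>)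
  then have q: "log_deriv (moment_fps (\<lambda>x. X x + R x)) =
      fps_of_poly (\<Sum>i<card K. monom (fps_nth (log_deriv (moment_fps (\<lambda>x. X x + R x))) i) i)"
    by (intro fps_ext) (auto simp: coeff_sum)
  have char_X: "(CLINT x|M. iexp (t * X x)) = exp (of_real (- expectation (\<lambda>x. (X x)\<^sup>2) * t\<^sup>2 / 2))" for t
  proof (rule char_of_summand[OF _ _ _ _ _ _ q])
    show "indep_var borel X borel R"
      unfolding X_def[abs_def] R_def[abs_def]
      by (rule indep_vars_linear_combination[OF J(1,2)]) (rule indep_vars_subset[OF indK], use J(3) K(3) in auto)
    show "integrable M X" "expectation X = 0"
      using int[OF K(3)] by (simp_all add: X_def[abs_def])
    show "integrable M R" "expectation R = 0"
      using int J(3) by (auto simp: R_def[abs_def] Bochner_Integration.integral_sum subset_iff)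
    show "all_moments (\<lambda>x. X x + R x)"
      unfolding S by (intro all_moments_sum all_moments_cmult mom) simp
  qed
  define v where "v = expectation (\<lambda>x. (\<epsilon> k x)\<^sup>2)"
  have sq: "integrable M (\<lambda>x. (\<epsilon> k x)\<^sup>2)" "random_variable borel (\<epsilon> k)"
    using noise[OF k(1)] by (simp_all add: centered_var_def)
  have "(CLINT x|M. iexp (t * \<epsilon> k x)) = exp (of_real (- v * t\<^sup>2 / 2))" for t
    using char_X[of "t / a k"] k(2) by (simp add: X_def v_def power_mult_distrib power_divide)
  \<comment> \<open>With v > 0 the characteristic function would be that of a nondegenerate normal
    law.\<close>
  then have "\<not> v > 0"
    using gaussian_of_char[OF sq(2)] nongaussian unfolding gaussian_def by blast
  moreover have "v \<ge> 0" unfolding v_def by simp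
  ultimately have "expectation (\<lambda>x. (\<epsilon> k x)\<^sup>2) = 0" unfolding v_def by linarith
  then have "AE x in M. (\<epsilon> k x)\<^sup>2 = 0"
    using integral_nonneg_eq_0_iff_AE[OF sq(1)] by simp
  then show ?thesis by simp
qed

end

section \<open>The linear model\<close>

lemma borel_measurable_vec_lambda:
  fixes f :: "'a \<Rightarrow> 'n::finite \<Rightarrow> real"
  assumes "\<And>i. (\<lambda>x. f x i) \<in> borel_measurable M"
  shows "(\<lambda>x. \<chi> i. f x i) \<in> borel_measurable M"
  using assms by (subst borel_measurable_euclidean_space) (auto simp: Basis_vec_def inner_axis)

section \<open>Independence of variables with different value spaces\<close>

context prob_space
begin

text \<open>Preimages of measurable sets are stable under intersection, so the product formula on
  them extends to the generated sigma-algebras.\<close>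

lemma indep_rv_iff:
  "indep_rv S X T Y \<longleftrightarrow> random_variable S X \<and> random_variable T Y \<and>
    (\<forall>A\<in>sets S. \<forall>B\<in>sets T. prob ((X -` A \<inter> space M) \<inter> (Y -` B \<inter> space M)) =
      prob (X -` A \<inter> space M) * prob (Y -` B \<inter> space M))" (is "_ \<longleftrightarrow> ?R")
proof
  assume "indep_rv S X T Y"
  then show ?R unfolding indep_rv_def indep_sets2_eq by blast
next
  assume R: ?R
  let ?G = "\<lambda>S X. {X -` A \<inter> space M |A. A \<in> sets S}"
  have stable: "Int_stable (?G S X)" for S and X :: "'a \<Rightarrow> 'd"
  proof (rule Int_stableI)
    fix a b assume "a \<in> ?G S X" "b \<in> ?G S X"
    then obtain A B where "a = X -` A \<inter> space M" "b = X -` B \<inter> space M" "A \<in> sets S" "B \<in> sets S" by blast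
    then have "a \<inter> b = X -` (A \<inter> B) \<inter> space M" "A \<inter> B \<in> sets S" by auto
    then show "a \<inter> b \<in> ?G S X" by blast
  qed
  have "indep_set (?G S X) (?G T Y)"
    unfolding indep_sets2_eq using R by (auto intro: measurable_sets)
  then have "indep_set (sigma_sets (space M) (?G S X)) (sigma_sets (space M) (?G T Y))"
    by (rule indep_set_sigma_sets[OF _ stable stable])
  then show "indep_rv S X T Y" using R by (simp add: indep_rv_def)
qed

lemma indep_rv_compose:
  assumes "indep_rv S X T Y" "f \<in> measurable S S'" "g \<in> measurable T T'"
  shows "indep_rv S' (\<lambda>x. f (X x)) T' (\<lambda>x. g (Y x))"
proof -
  have rv: "random_variable S X" "random_variable T Y" using assms(1) by (simp_all add: indep_rv_iff)
  have vim: "(\<lambda>x. f (X x)) -` A \<inter> space M = X -` (f -` A \<inter> space S) \<inter> space M" for A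
    using rv(1) by (auto dest: measurable_space)
  have vim': "(\<lambda>x. g (Y x)) -` A \<inter> space M = Y -` (g -` A \<inter> space T) \<inter> space M" for A
    using rv(2) by (auto dest: measurable_space)
  show ?thesis
    unfolding indep_rv_iff vim vim'
  proof (intro conjI ballI)
    fix A B assume "A \<in> sets S'" "B \<in> sets T'"
    then have "f -` A \<inter> space S \<in> sets S" "g -` B \<inter> space T \<in> sets T"
      using assms(2,3) by (auto intro: measurable_sets)
    then show "prob (X -` (f -` A \<inter> space S) \<inter> space M \<inter> (Y -` (g -` B \<inter> space T) \<inter> space M)) =
        prob (X -` (f -` A \<inter> space S) \<inter> space M) * prob (Y -` (g -` B \<inter> space T) \<inter> space M)"
      using assms(1) unfolding indep_rv_iff by blast
  qed (use measurable_compose[OF rv(1) assms(2)] measurable_compose[OF rv(2) assms(3)] in simp_all)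
qed

text \<open>The model equations hold only almost surely, so independence must survive changes on
  null sets.\<close>

lemma indep_rv_cong_AE:
  assumes "indep_rv S X T Y" and ae: "AE x in M. X x = X' x" "AE x in M. Y x = Y' x"
    and rv: "random_variable S X'" "random_variable T Y'"
  shows "indep_rv S X' T Y'"
proof -
  have rv0: "random_variable S X" "random_variable T Y" using assms(1) by (simp_all add: indep_rv_iff)
  have "prob ((X' -` A \<inter> space M) \<inter> (Y' -` B \<inter> space M)) = prob (X' -` A \<inter> space M) * prob (Y' -` B \<inter> space M)"
    if AB: "A \<in> sets S" "B \<in> sets T" for A B
  proof -
    have ev: "X -` A \<inter> space M \<in> events" "Y -` B \<inter> space M \<in> events"
      "X' -` A \<inter> space M \<in> events" "Y' -` B \<inter> space M \<in> events"
      using rv rv0 AB by (auto intro: measurable_sets)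
    have "prob (X -` A \<inter> space M) = prob (X' -` A \<inter> space M)"
      by (rule finite_measure_eq_AE) (use ae(1) ev in auto)
    moreover have "prob (Y -` B \<inter> space M) = prob (Y' -` B \<inter> space M)"
      by (rule finite_measure_eq_AE) (use ae(2) ev in auto)
    moreover have "prob ((X -` A \<inter> space M) \<inter> (Y -` B \<inter> space M)) = prob ((X' -` A \<inter> space M) \<inter> (Y' -` B \<inter> space M))"
      by (rule finite_measure_eq_AE) (use ae ev in auto)
    moreover have "prob ((X -` A \<inter> space M) \<inter> (Y -` B \<inter> space M)) = prob (X -` A \<inter> space M) * prob (Y -` B \<inter> space M)"
      using assms(1) AB by (simp add: indep_rv_iff)
    ultimately show ?thesis by simp
  qed
  with rv show ?thesis by (simp add: indep_rv_iff)
qed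

lemma centered_var_mult_integrable:
  assumes "centered_var X" "centered_var Y"
  shows "integrable M (\<lambda>x. X x * Y x)"
proof (rule Bochner_Integration.integrable_bound)
  have [measurable]: "random_variable borel X" "random_variable borel Y"
    using assms by (auto simp: centered_var_def)
  show "random_variable borel (\<lambda>x. X x * Y x)" by measurable
  show "integrable M (\<lambda>x. (X x)\<^sup>2 + (Y x)\<^sup>2)" using assms by (auto simp: centered_var_def)
  have "\<bar>a * b\<bar> \<le> \<bar>a\<^sup>2 + b\<^sup>2\<bar>" for a b :: real
    by (rule abs_mult_le_sum_squares)
  then show "AE x in M. norm (X x * Y x) \<le> norm ((X x)\<^sup>2 + (Y x)\<^sup>2)" by simp
qed

lemma centered_var_integrable:
  assumes "centered_var X"
  shows "integrable M X"
  using assms by (auto simp: centered_var_def intro: square_integrable_imp_integrable)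

text \<open>Components inherit independence from the vectors and may be replaced by their noise
  combinations; a common noise that is not almost surely zero would then contradict the
  Darmois-Skitovich theorem.\<close>

lemma noise_support_disjoint:
  fixes \<epsilon> :: "'i \<Rightarrow> 'a \<Rightarrow> real" and E :: "'a \<Rightarrow> real ^ 'n" and L :: "'a \<Rightarrow> real ^ 'l"
  assumes "finite I" and noise: "\<And>k. k \<in> I \<Longrightarrow> centered_var (\<epsilon> k)" "\<And>k. k \<in> I \<Longrightarrow> \<not> gaussian (\<epsilon> k)"
    and ind: "indep_vars (\<lambda>_. borel) \<epsilon> I"
    and E: "\<And>i. AE x in M. E x $ i = (\<Sum>k\<in>I. p i k * \<epsilon> k x)"
    and L: "\<And>j. AE x in M. L x $ j = (\<Sum>k\<in>I. q j k * \<epsilon> k x)"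
    and indep: "indep_rv borel E borel L"
    and k: "k \<in> I" "\<not> (AE x in M. \<epsilon> k x = 0)" "p i k \<noteq> 0"
  shows "q j k = 0"
proof (rule ccontr)
  assume "q j k \<noteq> 0"
  have "random_variable borel (\<epsilon> k)" if "k \<in> I" for k
    using noise(1)[OF that] by (simp add: centered_var_def)
  then have meas: "random_variable borel (\<lambda>x. \<Sum>k\<in>I. c k * \<epsilon> k x)" for c
    by (intro borel_measurable_sum borel_measurable_times borel_measurable_const)
  have "indep_rv borel (\<lambda>x. E x $ i) borel (\<lambda>x. L x $ j)"
    by (rule indep_rv_compose[OF indep]) auto
  then have "indep_rv borel (\<lambda>x. \<Sum>k\<in>I. p i k * \<epsilon> k x) borel (\<lambda>x. \<Sum>k\<in>I. q j k * \<epsilon> k x)"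
    by (rule indep_rv_cong_AE) (intro E L meas)+
  then have "AE x in M. \<epsilon> k x = 0"
    unfolding indep_rv_iff_indep_var
    using darmois_skitovich[where a="p i" and b="q j", OF \<open>finite I\<close> ind noise(1) _ k(1,3) \<open>q j k \<noteq> 0\<close> noise(2)[OF k(1)]] by blast
  with k(2) show False by contradiction
qed

text \<open>A noise that vanishes almost surely may carry any coefficient and is dropped just like
  one with coefficient 0.\<close>

lemma linear_combination_restrict:
  fixes \<epsilon> :: "'i \<Rightarrow> 'a \<Rightarrow> real"
  assumes "finite I" "J \<subseteq> I" and X: "AE x in M. X x = (\<Sum>k\<in>I. c k * \<epsilon> k x)"
    and rest: "\<And>k. k \<in> I - J \<Longrightarrow> c k = 0 \<or> (AE x in M. \<epsilon> k x = 0)"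
  shows "AE x in M. X x = (\<Sum>k\<in>J. c k * \<epsilon> k x)"
proof -
  have "AE x in M. c k * \<epsilon> k x = 0" if "k \<in> I - J" for k
    using rest[OF that] by auto
  then have "AE x in M. \<forall>k\<in>I - J. c k * \<epsilon> k x = 0"
    using \<open>finite I\<close> by (intro AE_finite_allI) auto
  with X show ?thesis
  proof eventually_elim
    case (elim x)
    then show ?case using assms(1,2) by (simp add: sum.mono_neutral_right)
  qed
qed

text \<open>Almost surely, \<open>E\<close> is a function of the noises in \<open>S\<close>. Neither
  \<open>L\<close> nor \<open>F\<close> involves these, so \<open>Z\<close> is a function of the
  complementary block, however \<open>L\<close> and \<open>F\<close> depend on each other.\<close>

lemma linear_model_independent:
  fixes \<epsilon> :: "'i \<Rightarrow> 'a \<Rightarrow> real" and L :: "'a \<Rightarrow> real ^ 'l" and E :: "'a \<Rightarrow> real ^ 'n" and F :: "'a \<Rightarrow> real ^ 'm"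
  assumes "finite I" and noise: "\<And>k. k \<in> I \<Longrightarrow> centered_var (\<epsilon> k)" "\<And>k. k \<in> I \<Longrightarrow> \<not> gaussian (\<epsilon> k)"
    and ind: "indep_vars (\<lambda>_. borel) \<epsilon> I"
    and L: "\<And>i. linear_combination_of \<epsilon> I (\<lambda>x. L x $ i)"
    and E: "\<And>i. linear_combination_of \<epsilon> I (\<lambda>x. E x $ i)"
    and F: "\<And>i. linear_combination_of \<epsilon> I (\<lambda>x. F x $ i)"
    and Z: "AE x in M. Z x = B *v L x + F x"
    and EL: "indep_rv borel E borel L" and EF: "indep_rv borel E borel F"
    and Z_meas: "random_variable borel Z"
  shows "indep_rv borel E borel Z"
proof -
  obtain q where q: "\<And>j. AE x in M. L x $ j = (\<Sum>k\<in>I. q j k * \<epsilon> k x)"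
    using L unfolding linear_combination_of_def by metis
  obtain p where p: "\<And>i. AE x in M. E x $ i = (\<Sum>k\<in>I. p i k * \<epsilon> k x)"
    using E unfolding linear_combination_of_def by metis
  obtain g where g: "\<And>i. AE x in M. F x $ i = (\<Sum>k\<in>I. g i k * \<epsilon> k x)"
    using F unfolding linear_combination_of_def by metis
  \<comment> \<open>The noises that really occur in \<open>E\<close>. Almost surely zero ones fall
    into the complement, where a nonzero coefficient in \<open>E\<close> has no effect.\<close>
  define S where "S = {k \<in> I. \<not> (AE x in M. \<epsilon> k x = 0) \<and> (\<exists>i. p i k \<noteq> 0)}"
  have S: "S \<subseteq> I" "I - S \<subseteq> I" "S \<inter> (I - S) = {}" by (auto simp: S_def)
  have qS: "q j k = 0" "g i k = 0" if "k \<in> S" for i j k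
    using that noise_support_disjoint[OF \<open>finite I\<close> noise ind p q EL] noise_support_disjoint[OF \<open>finite I\<close> noise ind p g EF]
    by (auto simp: S_def)
  have E': "AE x in M. E x = (\<chi> i. \<Sum>k\<in>S. p i k * \<epsilon> k x)"
  proof -
    have "AE x in M. E x $ i = (\<Sum>k\<in>S. p i k * \<epsilon> k x)" for i
      by (rule linear_combination_restrict[OF \<open>finite I\<close> S(1) p]) (auto simp: S_def)
    then show ?thesis by (simp add: vec_eq_iff AE_all_countable)
  qed
  \<comment> \<open>Noise coefficients of \<open>Z\<close> after substituting the combinations for
    \<open>L\<close> and \<open>F\<close>.\<close>
  define C where "C j k = (\<Sum>l\<in>UNIV. B $ j $ l * q l k) + g j k" for j k
  have Z': "AE x in M. Z x = (\<chi> j. \<Sum>k\<in>I - S. C j k * \<epsilon> k x)"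
  proof -
    have "AE x in M. \<forall>l. L x $ l = (\<Sum>k\<in>I - S. q l k * \<epsilon> k x)"
      by (subst AE_all_countable) (intro allI linear_combination_restrict[OF \<open>finite I\<close> S(2) q], use qS in auto)
    moreover have "AE x in M. \<forall>j. F x $ j = (\<Sum>k\<in>I - S. g j k * \<epsilon> k x)"
      by (subst AE_all_countable) (intro allI linear_combination_restrict[OF \<open>finite I\<close> S(2) g], use qS in auto)
    ultimately show ?thesis using Z
    proof eventually_elim
      case (elim x)
      have "(\<Sum>l\<in>UNIV. B $ j $ l * (\<Sum>k\<in>I - S. q l k * \<epsilon> k x)) = (\<Sum>k\<in>I - S. (\<Sum>l\<in>UNIV. B $ j $ l * q l k) * \<epsilon> k x)" for j
        unfolding sum_distrib_left sum_distrib_right by (subst sum.swap) (simp add: mult.assoc)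
      then show ?case
        using elim by (simp add: vec_eq_iff matrix_vector_mult_def C_def distrib_right sum.distrib)
    qed
  qed
  \<comment> \<open>Disjoint blocks of independent noises are independent as families, and both
    vectors are measurable functions of their blocks.\<close>
  have "indep_rv (PiM S (\<lambda>_. borel)) (\<lambda>x. restrict (\<lambda>i. \<epsilon> i x) S) (PiM (I - S) (\<lambda>_. borel)) (\<lambda>x. restrict (\<lambda>i. \<epsilon> i x) (I - S))"
    unfolding indep_rv_iff_indep_var by (rule indep_var_restrict[OF ind S(3,1,2)])
  then have "indep_rv borel (\<lambda>x. \<chi> i. \<Sum>k\<in>S. p i k * restrict (\<lambda>i. \<epsilon> i x) S k)
      borel (\<lambda>x. \<chi> j. \<Sum>k\<in>I - S. C j k * restrict (\<lambda>i. \<epsilon> i x) (I - S) k)"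
    by (rule indep_rv_compose[where f="\<lambda>v. \<chi> i. \<Sum>k\<in>S. p i k * v k" and g="\<lambda>v. \<chi> j. \<Sum>k\<in>I - S. C j k * v k"])
      (intro borel_measurable_vec_lambda borel_measurable_sum borel_measurable_times borel_measurable_const measurable_component_singleton; assumption)+
  then have "indep_rv borel (\<lambda>x. \<chi> i. \<Sum>k\<in>S. p i k * \<epsilon> k x) borel (\<lambda>x. \<chi> j. \<Sum>k\<in>I - S. C j k * \<epsilon> k x)"
    by simp
  moreover have "AE x in M. (\<chi> i. \<Sum>k\<in>S. p i k * \<epsilon> k x) = E x"
    using E' by eventually_elim simp
  moreover have "AE x in M. (\<chi> j. \<Sum>k\<in>I - S. C j k * \<epsilon> k x) = Z x"
    using Z' by eventually_elim simp
  moreover have "random_variable borel E" using EL by (simp add: indep_rv_iff)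
  ultimately show ?thesis using Z_meas by (rule indep_rv_cong_AE)
qed

text \<open>The contribution of \<open>E\<close> vanishes because its components have mean zero and
  are independent of those of \<open>Z\<close>. Square integrability makes every product
  integrable.\<close>

lemma cross_cov_factor:
  fixes A :: "real ^ 'l ^ 'n" and Z :: "'a \<Rightarrow> real ^ 'm"
  assumes L: "centered_vec L" and E: "centered_vec E" and Z: "centered_vec Z" and Y: "centered_vec Y"
    and Y_eq: "AE x in M. Y x = A *v L x + E x" and indep: "indep_rv borel E borel Z"
  shows "cross_cov Y Z = A ** cross_cov L Z"
proof -
  have comp: "centered_var (\<lambda>x. V x $ i)" if "centered_vec V" for V :: "'a \<Rightarrow> real ^ 'd" and i
    using that by (simp add: centered_vec_def)
  have "expectation (\<lambda>x. Y x $ i * Z x $ j) = (\<Sum>k\<in>UNIV. A $ i $ k * expectation (\<lambda>x. L x $ k * Z x $ j))" for i j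
  proof -
    have "indep_rv borel (\<lambda>x. E x $ i) borel (\<lambda>x. Z x $ j)"
      by (rule indep_rv_compose[OF indep]) auto
    then have "expectation (\<lambda>x. E x $ i * Z x $ j) = expectation (\<lambda>x. E x $ i) * expectation (\<lambda>x. Z x $ j)"
      unfolding indep_rv_iff_indep_var
      by (intro indep_var_lebesgue_integral centered_var_integrable comp E Z)
    then have EZ: "expectation (\<lambda>x. E x $ i * Z x $ j) = 0"
      using comp[OF E, of i] by (simp add: centered_var_def)
    have meas: "random_variable borel (\<lambda>x. V x $ k)" if "centered_vec V" for V :: "'a \<Rightarrow> real ^ 'd" and k
      using comp[OF that] by (simp add: centered_var_def)
    have "expectation (\<lambda>x. Y x $ i * Z x $ j) = expectation (\<lambda>x. (\<Sum>k\<in>UNIV. A $ i $ k * (L x $ k * Z x $ j)) + E x $ i * Z x $ j)"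
    proof (rule integral_cong_AE)
      show "AE x in M. Y x $ i * Z x $ j = (\<Sum>k\<in>UNIV. A $ i $ k * (L x $ k * Z x $ j)) + E x $ i * Z x $ j"
        using Y_eq by eventually_elim (simp add: matrix_vector_mult_def distrib_right sum_distrib_right mult.assoc)
    qed (intro borel_measurable_add borel_measurable_sum borel_measurable_times borel_measurable_const meas L E Z Y)+
    also have "\<dots> = (\<Sum>k\<in>UNIV. A $ i $ k * expectation (\<lambda>x. L x $ k * Z x $ j)) + expectation (\<lambda>x. E x $ i * Z x $ j)"
      by (simp add: centered_var_mult_integrable comp L E Z)
    finally show ?thesis using EZ by simp
  qed
  then show ?thesis by (simp add: cross_cov_def matrix_matrix_mult_def vec_eq_iff)
qed

end

section \<open>Left kernels of the coefficient and cross-covariance matrices\<close>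

lemma exists_left_kernel_vector:
  fixes A :: "real ^ 'l ^ 'n"
  assumes "rank A < CARD('n)"
  shows "\<exists>w. w \<noteq> 0 \<and> w v* A = 0"
proof -
  have "rank (transpose A) \<noteq> CARD('n)" using assms by (simp add: rank_transpose)
  then have "\<not> inj ((*v) (transpose A))" by (simp add: full_rank_injective)
  then obtain w where "w \<noteq> 0" "transpose A *v w = 0"
    using linear_injective_0[OF matrix_vector_mul_linear] by blast
  then show ?thesis by auto
qed

text \<open>Full row rank makes the transpose injective; this is what cancels the factor E[L Z^T] on
  the right.\<close>

lemma left_kernel_trivial:
  fixes C :: "real ^ 'm ^ 'l"
  assumes "rank C = CARD('l)" "u v* C = 0"
  shows "u = 0"
proof -
  have "inj ((*v) (transpose C))" using assms(1) by (simp add: rank_transpose flip: full_rank_injective)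
  moreover have "transpose C *v u = 0" using assms(2) by simp
  ultimately show ?thesis using linear_injective_0[OF matrix_vector_mul_linear] by blast
qed

theorem theorem1:
  fixes M :: "'a measure"
    and L :: "'a \<Rightarrow> real ^ 'l"
    and Y E\<^sub>Y :: "'a \<Rightarrow> real ^ 'n"
    and Z E\<^sub>Z :: "'a \<Rightarrow> real ^ 'm"
    and A :: "real ^ 'l ^ 'n"
    and B :: "real ^ 'l ^ 'm"
    and \<epsilon> :: "'i \<Rightarrow> 'a \<Rightarrow> real"
    and I :: "'i set"
  assumes "prob_space M"
    and "prob_space.centered_vec M L"
    and "prob_space.centered_vec M Y" and "prob_space.centered_vec M E\<^sub>Y"
    and "prob_space.centered_vec M Z" and "prob_space.centered_vec M E\<^sub>Z"
    and "finite I"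
    and "\<And>k. k \<in> I \<Longrightarrow> prob_space.centered_var M (\<epsilon> k)"
    and "\<And>k. k \<in> I \<Longrightarrow> \<not> prob_space.gaussian M (\<epsilon> k)"
    and "prob_space.indep_vars M (\<lambda>_. borel) \<epsilon> I"
    and "\<And>i. prob_space.linear_combination_of M \<epsilon> I (\<lambda>x. L x $ i)"
    and "\<And>i. prob_space.linear_combination_of M \<epsilon> I (\<lambda>x. E\<^sub>Y x $ i)"
    and "\<And>i. prob_space.linear_combination_of M \<epsilon> I (\<lambda>x. E\<^sub>Z x $ i)"
    and "AE x in M. Y x = A *v L x + E\<^sub>Y x"
    and "AE x in M. Z x = B *v L x + E\<^sub>Z x"
    and "rank A = CARD('l)"
    and "CARD('n) > CARD('l)"
    and "prob_space.indep_rv M borel E\<^sub>Y borel L"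
    and "prob_space.indep_rv M borel E\<^sub>Y borel E\<^sub>Z"
    and "rank (prob_space.cross_cov M L Z) = CARD('l)"
  shows "prob_space.GIN M Z Y"
proof -
  interpret prob_space M by fact
  have meas: "random_variable borel Y" "random_variable borel Z"
    using assms(3,5) unfolding centered_vec_def by blast+
  have EZ: "indep_rv borel E\<^sub>Y borel Z"
    by (rule linear_model_independent[OF assms(7-13) assms(15) assms(18,19) meas(2)])
  have cov: "cross_cov Y Z = A ** cross_cov L Z"
    by (rule cross_cov_factor[OF assms(2,4,5,3,14) EZ])
  have kernel: "w v* cross_cov Y Z = (w v* A) v* cross_cov L Z" for w
    by (simp add: cov vector_matrix_mul_assoc)
  \<comment> \<open>The rank of \<open>A\<close> is l < Dim(Y), so some nonzero vector annihilates
    \<open>A\<close> and with it the cross-covariance: a surrogate exists.\<close>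
  obtain w where "w \<noteq> 0" "w v* A = 0"
    using exists_left_kernel_vector[of A] assms(16,17) by auto
  then have "w \<in> surrogate_coeffs Y Z"
    by (simp add: surrogate_coeffs_def kernel)
  moreover have "indep_rv borel (\<lambda>x. w \<bullet> Y x) borel Z" if w: "w \<in> surrogate_coeffs Y Z" for w
  proof (rule indep_rv_cong_AE)
    show "indep_rv borel (\<lambda>x. w \<bullet> E\<^sub>Y x) borel Z"
      by (rule indep_rv_compose[OF EZ, where g="\<lambda>z. z"]) auto
    \<comment> \<open>The rank of \<open>cross_cov L Z\<close> lets this factor be cancelled; the
      part of the surrogate coming from \<open>L\<close> then disappears and only the noise part
      remains.\<close>
    have "w v* A = 0"
      using w left_kernel_trivial[OF assms(20), of "w v* A"] by (simp add: surrogate_coeffs_def kernel)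
    then have "w \<bullet> (A *v v) = 0" for v
      by (simp flip: dot_lmul_matrix)
    with assms(14) show "AE x in M. w \<bullet> E\<^sub>Y x = w \<bullet> Y x"
      by (auto simp: inner_add_right)
  qed (use meas in simp_all)
  ultimately show ?thesis unfolding GIN_def by blast
qed

end
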